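(* Consider the following online scheduling problem. There is an unlimited supply of servers. Jobs arrive over time at arbitrary times $a_j$ with arbitrary sizes $w_j>0$, and the algorithm learns of a job only at its arrival. At any time each job can be processed by at most one server; preemption is allowed (a job can be halted and resumed later on any server). A server running at speed $s$ consumes power $P(s)=s^\alpha$ with fixed $\alpha>1$; running at speed $s$ for duration $t$ completes $st$ units of the job's work. At every time $t$ the active server speeds must satisfy $\sum_{i:s_i(t)>0}P(s_i(t))\le\mathbf{p}$ for a given $\mathbf{p}>0$. The objective (flow time plus energy) is $$\int n(t)\,dt+\int\sum_{i:s_i(t)>0}P(s_i(t))\,dt,$$ where $n(t)$ is the number of unfinished jobs at time $t$ (so $\int n(t)\,dt=\sum_j(d_j-a_j)$, $d_j$ the completion time of job $j$). Algorithm Fractional-LCFS-EQUI with parameter $\beta<1$: at each time $t$, with $n(t)$ unfinished jobs, it processes the $\lceil\beta n(t)\rceil$ unfinished jobs that arrived most recently, each on its own server, all at the equal speed $s(t)=P^{-1}\!\left(\frac{\min\{n(t),\mathbf{p}\}}{\beta n(t)}\right)$ (with $\beta n(t)$ understood as $\lceil \beta n(t)\rceil$). Then for any $\alpha>1$ there exists $\beta<1$ such that the competitive ratio of Fractional-LCFS-EQUI for this flow time plus energy problem is a constant that depends only on $\alpha$ and is independent of the number of jobs and their sizes. For example, for $2\le\alpha\le3$, with $\beta=\frac{1}{6}$ the competitive ratio is at most $693$.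
   Context: The competitive ratio of an online algorithm $\mathcal{A}$ is $\max_\sigma \frac{\int (n(t)+P_{\mathrm{sum}}(t))\,dt}{\int (n_o(t)+P^o_{\mathrm{sum}}(t))\,dt}$, where the maximum is over all inputs $\sigma$ (arbitrary arrival times and sizes), $n(t)$ and $P_{\mathrm{sum}}(t)$ are the number of unfinished jobs and total power used at time $t$ by $\mathcal{A}$, and $n_o(t)$, $P^o_{\mathrm{sum}}(t)$ are the same quantities for an optimal offline algorithm that knows the entire input in advance and satisfies the same constraints. *)

theory Defs
  imports "HOL-Analysis.Analysis"
begin

text \<open>
  An input is the finite sequence of its jobs, each a pair (arrival time, size), listed in order
  of arrival. Among jobs with equal arrival times, the one that is later in the list counts as the
  more recent one; as every order of simultaneous jobs is itself an input, all such tie-breaking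
  orders are covered.
\<close>

type_synonym input = "(real \<times> real) list"

definition arrival :: "input \<Rightarrow> nat \<Rightarrow> real" where
  "arrival I j = fst (I ! j)"

definition size_of :: "input \<Rightarrow> nat \<Rightarrow> real" where
  "size_of I j = snd (I ! j)"

definition valid_input :: "input \<Rightarrow> bool" where
  "valid_input I \<longleftrightarrow> I \<noteq> [] \<and> sorted (map fst I) \<and> (\<forall>j<length I. size_of I j > 0)"

text \<open>The servers are numbered by the natural numbers; a server without a job is idle.\<close>

record schedule =
  server_job :: "nat \<Rightarrow> real \<Rightarrow> nat option"
  server_speed :: "nat \<Rightarrow> real \<Rightarrow> real"

definition job_speed :: "schedule \<Rightarrow> nat \<Rightarrow> real \<Rightarrow> real" where
  "job_speed S j t = (\<Sum>i | server_job S i t = Some j. server_speed S i t)"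

definition work :: "input \<Rightarrow> schedule \<Rightarrow> nat \<Rightarrow> real \<Rightarrow> real" where
  "work I S j t = (LINT \<tau>:{arrival I j..t}|lborel. job_speed S j \<tau>)"

definition unfinished :: "input \<Rightarrow> schedule \<Rightarrow> real \<Rightarrow> nat set" where
  "unfinished I S t = {j. j < length I \<and> arrival I j \<le> t \<and> work I S j t < size_of I j}"

definition legal_schedule :: "input \<Rightarrow> schedule \<Rightarrow> bool" where
  "legal_schedule I S \<longleftrightarrow>
     (\<forall>i. server_speed S i \<in> borel_measurable borel) \<and>
     (\<forall>i j. {t. server_job S i t = Some j} \<in> sets borel) \<and>
     (\<forall>i t. server_speed S i t \<ge> 0) \<and>
     (\<forall>i t. server_job S i t = None \<longrightarrow> server_speed S i t = 0) \<and>
     (\<forall>i t j. server_job S i t = Some j \<longrightarrow> j \<in> unfinished I S t) \<and>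
     (\<forall>i i' t j. server_job S i t = Some j \<and> server_job S i' t = Some j \<longrightarrow> i = i')"

definition srv_power :: "real \<Rightarrow> real \<Rightarrow> real" where
  "srv_power \<alpha> s = s powr \<alpha>"

definition srv_power_inv :: "real \<Rightarrow> real \<Rightarrow> real" where
  "srv_power_inv \<alpha> = inv_into {0..} (srv_power \<alpha>)"

definition total_power :: "real \<Rightarrow> schedule \<Rightarrow> real \<Rightarrow> real" where
  "total_power \<alpha> S t = (\<Sum>i | server_speed S i t > 0. srv_power \<alpha> (server_speed S i t))"

definition feasible :: "real \<Rightarrow> real \<Rightarrow> input \<Rightarrow> schedule \<Rightarrow> bool" where
  "feasible \<alpha> p I S \<longleftrightarrow> legal_schedule I S \<and> (\<forall>t. total_power \<alpha> S t \<le> p)"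

text \<open>Flow time plus energy; it is infinite if some job is never finished.\<close>

definition cost :: "real \<Rightarrow> input \<Rightarrow> schedule \<Rightarrow> ennreal" where
  "cost \<alpha> I S = (\<integral>\<^sup>+t. of_nat (card (unfinished I S t)) \<partial>lborel)
              + (\<integral>\<^sup>+t. ennreal (total_power \<alpha> S t) \<partial>lborel)"

definition opt_cost :: "real \<Rightarrow> real \<Rightarrow> input \<Rightarrow> ennreal" where
  "opt_cost \<alpha> p I = (INF S\<in>{S. feasible \<alpha> p I S}. cost \<alpha> I S)"

text \<open>An algorithm is given by the set of schedules that it can produce on each input.\<close>

definition competitive_ratio :: "real \<Rightarrow> real \<Rightarrow> (input \<Rightarrow> schedule set) \<Rightarrow> ennreal" where
  "competitive_ratio \<alpha> p A =
     (SUP I\<in>{I. valid_input I}. SUP S\<in>A I. cost \<alpha> I S / opt_cost \<alpha> p I)"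

definition most_recent :: "nat \<Rightarrow> nat set \<Rightarrow> nat set" where
  "most_recent k U = {j \<in> U. card {i \<in> U. j < i} < k}"

definition lcfs_count :: "real \<Rightarrow> nat \<Rightarrow> nat" where
  "lcfs_count \<beta> n = nat \<lceil>\<beta> * real n\<rceil>"

definition lcfs_speed :: "real \<Rightarrow> real \<Rightarrow> real \<Rightarrow> nat \<Rightarrow> real" where
  "lcfs_speed \<alpha> p \<beta> n = srv_power_inv \<alpha> (min (real n) p / real (lcfs_count \<beta> n))"

text \<open>
  The schedules of Fractional-LCFS-EQUI: the rule refers to the set of unfinished jobs of the very
  schedule it generates. The schedules on a given input differ only in which server runs which job.
  That they exist and obey the power constraint is shown below.
\<close>

definition frac_lcfs_equi :: "real \<Rightarrow> real \<Rightarrow> real \<Rightarrow> input \<Rightarrow> schedule set" where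
  "frac_lcfs_equi \<alpha> p \<beta> I =
     {S. legal_schedule I S \<and>
         (\<forall>t. let U = unfinished I S t; n = card U in
              {j. \<exists>i. server_job S i t = Some j} = most_recent (lcfs_count \<beta> n) U \<and>
              (\<forall>i j. server_job S i t = Some j \<longrightarrow> server_speed S i t = lcfs_speed \<alpha> p \<beta> n))}"

subsection \<open>Well-definedness of the algorithm\<close>

lemma srv_power_inv_eq:
  assumes "\<alpha> > 0" "y \<ge> 0"
  shows "srv_power_inv \<alpha> y = y powr (1 / \<alpha>)"
proof -
  have inj: "inj_on (srv_power \<alpha>) {0..}"
  proof (rule inj_onI)
    fix x z :: real
    assume "x \<in> {0..}" "z \<in> {0..}" "srv_power \<alpha> x = srv_power \<alpha> z"
    then have "(x powr \<alpha>) powr (1/\<alpha>) = (z powr \<alpha>) powr (1/\<alpha>)" "x \<ge> 0" "z \<ge> 0"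
      by (auto simp: srv_power_def)
    then show "x = z" using assms by (simp add: powr_powr)
  qed
  have "srv_power \<alpha> (y powr (1/\<alpha>)) = y"
    using assms by (simp add: srv_power_def powr_powr)
  then show ?thesis
    unfolding srv_power_inv_def using inv_into_f_f[OF inj, of "y powr (1/\<alpha>)"] by simp
qed

lemma lcfs_count_pos: "\<beta> > 0 \<Longrightarrow> n > 0 \<Longrightarrow> lcfs_count \<beta> n > 0"
  by (simp add: lcfs_count_def)

lemma lcfs_speed_nonneg:
  assumes "\<alpha> > 0" "p > 0"
  shows "lcfs_speed \<alpha> p \<beta> n \<ge> 0"
  using assms by (simp add: lcfs_speed_def srv_power_inv_eq)

lemma lcfs_speed_pos:
  assumes "\<alpha> > 0" "p > 0" "\<beta> > 0" "n > 0"
  shows "lcfs_speed \<alpha> p \<beta> n > 0"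
  using assms lcfs_count_pos[of \<beta> n] by (simp add: lcfs_speed_def srv_power_inv_eq)

lemma finite_unfinished: "finite (unfinished I S t)"
  by (rule finite_subset[of _ "{..<length I}"]) (auto simp: unfinished_def)

lemma card_most_recent_le:
  assumes "finite U"
  shows "card (most_recent k U) \<le> k"
proof (cases "most_recent k U = {}")
  case False
  let ?M = "most_recent k U"
  have fin: "finite ?M" using assms by (simp add: most_recent_def)
  let ?m = "Min ?M"
  have m: "?m \<in> ?M" using Min_in[OF fin False] .
  have "?M \<subseteq> insert ?m {i \<in> U. ?m < i}"
    using Min_le[OF fin] by (auto simp: most_recent_def order.strict_iff_order)
  then have "card ?M \<le> card (insert ?m {i \<in> U. ?m < i})"
    using assms by (intro card_mono) auto
  also have "\<dots> \<le> k" using m assms by (simp add: most_recent_def)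
  finally show ?thesis .
qed simp

theorem frac_lcfs_equi_feasible:
  assumes "\<alpha> > 0" "p > 0" "S \<in> frac_lcfs_equi \<alpha> p \<beta> I"
  shows "feasible \<alpha> p I S"
  unfolding feasible_def
proof (intro conjI allI)
  show legal: "legal_schedule I S" using assms by (simp add: frac_lcfs_equi_def)
  fix t
  define U where "U = unfinished I S t"
  define n where "n = card U"
  define k where "k = lcfs_count \<beta> n"
  define Q where "Q = {i. server_speed S i t > 0}"
  have jobs: "{j. \<exists>i. server_job S i t = Some j} = most_recent k U"
    and speed: "\<And>i j. server_job S i t = Some j \<Longrightarrow> server_speed S i t = lcfs_speed \<alpha> p \<beta> n"
    using assms(3) by (auto simp: frac_lcfs_equi_def Let_def U_def n_def k_def)
  have some: "\<exists>j. server_job S i t = Some j" if "i \<in> Q" for i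
    using legal that by (cases "server_job S i t") (auto simp: legal_schedule_def Q_def)
  have sub: "(\<lambda>i. the (server_job S i t)) ` Q \<subseteq> most_recent k U"
    unfolding jobs[symmetric] using some by fastforce
  have inj: "inj_on (\<lambda>i. the (server_job S i t)) Q"
  proof (rule inj_onI)
    fix i i' assume "i \<in> Q" "i' \<in> Q" "the (server_job S i t) = the (server_job S i' t)"
    then obtain j where "server_job S i t = Some j" "server_job S i' t = Some j"
      using some by (metis option.sel)
    then show "i = i'" using legal unfolding legal_schedule_def by blast
  qed
  have finU: "finite U" by (simp add: U_def finite_unfinished)
  have "card Q \<le> card (most_recent k U)"
    by (rule card_inj_on_le[OF inj sub]) (simp add: most_recent_def finU)
  then have cQ: "card Q \<le> k" using card_most_recent_le[OF finU, of k] by linarith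
  have "total_power \<alpha> S t = (\<Sum>i\<in>Q. min (real n) p / real k)"
    unfolding total_power_def Q_def[symmetric]
  proof (rule sum.cong)
    fix i assume "i \<in> Q"
    then have "server_speed S i t = lcfs_speed \<alpha> p \<beta> n" using some speed by blast
    then show "srv_power \<alpha> (server_speed S i t) = min (real n) p / real k"
      using assms by (simp add: lcfs_speed_def srv_power_inv_eq srv_power_def powr_powr k_def)
  qed simp
  also have "\<dots> = real (card Q) * (min (real n) p / real k)" by simp
  also have "\<dots> \<le> real k * (min (real n) p / real k)"
    using cQ assms by (intro mult_right_mono) auto
  also have "\<dots> \<le> p" using assms by (cases "k = 0") auto
  finally show "total_power \<alpha> S t \<le> p" .
qed

context
  fixes \<alpha> p \<beta> :: real and I :: input
  assumes \<alpha>: "\<alpha> > 0" and p: "p > 0" and \<beta>: "\<beta> > 0"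
begin

private definition act :: "nat set \<Rightarrow> nat set" where
  "act V = most_recent (lcfs_count \<beta> (card V)) V"

private definition vel :: "nat set \<Rightarrow> real" where
  "vel V = lcfs_speed \<alpha> p \<beta> (card V)"

private definition rate :: "nat \<Rightarrow> nat set \<Rightarrow> real" where
  "rate j V = (if j \<in> act V then vel V else 0)"

private definition sched :: "(real \<Rightarrow> nat set) \<Rightarrow> schedule" where
  "sched U = \<lparr> server_job = (\<lambda>i t. if i \<in> act (U t) then Some i else None),
               server_speed = (\<lambda>i t. rate i (U t)) \<rparr>"

private definition adm :: "(real \<Rightarrow> nat set) \<Rightarrow> bool" where
  "adm U \<longleftrightarrow> (\<forall>t. U t \<subseteq> {..<length I}) \<and> (\<forall>X. {t. U t = X} \<in> sets borel)"

private definition good :: "(real \<Rightarrow> nat set) \<Rightarrow> real \<Rightarrow> bool" where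
  "good U T \<longleftrightarrow> adm U \<and> (\<forall>t<T. unfinished I (sched U) t = U t)"

private definition arrived :: "real \<Rightarrow> nat set" where
  "arrived T = {j. j < length I \<and> arrival I j \<le> T}"

private definition fini :: "(real \<Rightarrow> nat set) \<Rightarrow> real \<Rightarrow> nat set" where
  "fini U T = {j \<in> arrived T. work I (sched U) j T \<ge> size_of I j}"

private lemma unfinished_eq: "unfinished I (sched U) t = arrived t - fini U t"
  by (auto simp: unfinished_def arrived_def fini_def)

private lemma rate_nonneg: "rate j V \<ge> 0"
  using lcfs_speed_nonneg[OF \<alpha> p] by (simp add: rate_def vel_def)

private lemma act_subset: "act V \<subseteq> V"
  by (auto simp: act_def most_recent_def)

private lemma act_nonempty:
  assumes "finite V" "V \<noteq> {}"
  shows "act V \<noteq> {}"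
proof -
  have "{i \<in> V. Max V < i} = {}" using assms Max_ge leD by blast
  then have "card {i \<in> V. Max V < i} = 0" by (metis card.empty)
  moreover have "lcfs_count \<beta> (card V) > 0"
    using assms lcfs_count_pos[OF \<beta>, of "card V"] by (simp add: card_gt_0_iff)
  ultimately have "card {i \<in> V. Max V < i} < lcfs_count \<beta> (card V)" by linarith
  then have "Max V \<in> act V"
    using Max_in[OF assms] unfolding act_def most_recent_def by blast
  then show ?thesis by blast
qed

private lemma vel_pos: "finite V \<Longrightarrow> V \<noteq> {} \<Longrightarrow> vel V > 0"
  using lcfs_speed_pos[OF \<alpha> p \<beta>, of "card V"] by (simp add: vel_def card_gt_0_iff)

private lemma job_speed_sched: "job_speed (sched U) j t = rate j (U t)"
proof -
  have "{i. server_job (sched U) i t = Some j} = (if j \<in> act (U t) then {j} else {})"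
    by (auto simp: sched_def)
  then show ?thesis by (simp add: job_speed_def sched_def rate_def)
qed

private lemma adm_measurable:
  fixes f :: "nat set \<Rightarrow> real"
  assumes "adm U"
  shows "(\<lambda>t. f (U t)) \<in> borel_measurable borel"
proof -
  have *: "U \<in> borel \<rightarrow>\<^sub>M count_space (Pow {..<length I})"
  proof (subst measurable_count_space_eq2)
    show "finite (Pow {..<length I})" by simp
    have "U -` {X} \<inter> space borel = {t. U t = X}" for X by auto
    then show "U \<in> space borel \<rightarrow> Pow {..<length I} \<and>
        (\<forall>a\<in>Pow {..<length I}. U -` {a} \<inter> space borel \<in> sets borel)"
      using assms by (auto simp: adm_def)
  qed
  have "f \<in> count_space (Pow {..<length I}) \<rightarrow>\<^sub>M borel" by simp
  from measurable_compose[OF * this] show ?thesis .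
qed

private lemma rate_integrable:
  assumes "adm U"
  shows "set_integrable lborel {a..<b} (\<lambda>t. rate j (U t))"
proof -
  define B where "B = Max (rate j ` Pow {..<length I})"
  have B: "norm (rate j (U t)) \<le> B" for t
  proof -
    have "rate j (U t) \<in> rate j ` Pow {..<length I}" using assms by (auto simp: adm_def)
    then have "rate j (U t) \<le> B" unfolding B_def by (intro Max_ge) auto
    then show ?thesis using rate_nonneg by simp
  qed
  show ?thesis unfolding set_integrable_def
  proof (rule integrableI_bounded_set_indicator[where B = B])
    show "{a..<b} \<in> sets lborel" by simp
    show "(\<lambda>t. rate j (U t)) \<in> borel_measurable lborel"
      using adm_measurable[OF assms, of "rate j"] by simp
    show "emeasure lborel {a..<b} < \<infinity>" by (cases "a \<le> b") auto
    show "AE x in lborel. x \<in> {a..<b} \<longrightarrow> norm (rate j (U x)) \<le> B" using B by simp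
  qed
qed

private lemma work_sched:
  assumes "adm U"
  shows "work I (sched U) j t = (LINT \<tau>:{arrival I j..<t}|lborel. rate j (U \<tau>))"
  unfolding work_def job_speed_sched
proof (rule set_integral_cong_set)
  have m: "(\<lambda>t. rate j (U t)) \<in> borel_measurable borel"
    using adm_measurable[OF assms, of "rate j"] .
  show "set_borel_measurable lborel {arrival I j..t} (\<lambda>\<tau>. rate j (U \<tau>))"
       "set_borel_measurable lborel {arrival I j..<t} (\<lambda>\<tau>. rate j (U \<tau>))"
    unfolding set_borel_measurable_def using m by simp_all
  have "AE x in lborel. x \<noteq> t" by (rule AE_lborel_singleton)
  then show "AE x in lborel. (x \<in> {arrival I j..<t}) = (x \<in> {arrival I j..t})"
    by eventually_elim auto
qed

private lemma work_cong:
  assumes "adm U" "adm U'" "\<And>t. t < T \<Longrightarrow> U t = U' t"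
  shows "work I (sched U) j T = work I (sched U') j T"
  unfolding work_sched[OF assms(1)] work_sched[OF assms(2)]
  by (rule set_lebesgue_integral_cong) (use assms(3) in auto)

private lemma work_extend:
  assumes "adm U" "\<And>t. T \<le> t \<Longrightarrow> U t = V" "arrival I j \<le> T" "T \<le> t"
  shows "work I (sched U) j t = work I (sched U) j T + (t - T) * rate j V"
proof -
  have split: "{arrival I j..<t} = {arrival I j..<T} \<union> {T..<t}" using assms by auto
  have "(LINT \<tau>:{T..<t}|lborel. rate j (U \<tau>)) = (LINT \<tau>:{T..<t}|lborel. rate j V)"
    by (rule set_lebesgue_integral_cong) (use assms(2) in auto)
  also have "\<dots> = (t - T) * rate j V"
    using assms(4) by (simp add: set_lebesgue_integral_def)
  finally show ?thesis
    unfolding work_sched[OF assms(1)] split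
    by (subst set_integral_Un) (auto intro!: rate_integrable assms)
qed

private lemma step:
  assumes g: "good U T"
  shows "(\<exists>U'. \<forall>T. good U' T) \<or>
         (\<exists>U' T'. good U' T' \<and> card (arrived T) + card (fini U T) < card (arrived T') + card (fini U' T'))"
proof -
  define V where "V = unfinished I (sched U) T"
  define U' where "U' = (\<lambda>t. if t < T then U t else V)"
  define E where "E = {arrival I j | j. j < length I \<and> arrival I j > T} \<union>
      (\<lambda>j. T + (size_of I j - work I (sched U) j T) / vel V) ` act V"
  have aU: "adm U" using g by (simp add: good_def)
  have finV: "finite V" by (simp add: V_def finite_unfinished)
  have finA: "finite (act V)" using finite_subset[OF act_subset finV] .
  have finE: "finite E" unfolding E_def using finA by auto
  have aU': "adm U'"
    unfolding adm_def
  proof (intro conjI allI)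
    show "U' t \<subseteq> {..<length I}" for t
      using aU by (auto simp: U'_def adm_def V_def unfinished_def)
    fix X
    have "{t. U' t = X} = ({..<T} \<inter> {t. U t = X}) \<union> ({T..} \<inter> (if V = X then UNIV else {}))"
      by (auto simp: U'_def)
    also have "\<dots> \<in> sets borel" using aU by (auto simp: adm_def)
    finally show "{t. U' t = X} \<in> sets borel" .
  qed
  have eqW: "work I (sched U') j t = work I (sched U) j t" if "t \<le> T" for j t
    by (rule work_cong[OF aU' aU]) (use that in \<open>auto simp: U'_def\<close>)
  have ext: "work I (sched U') j t = work I (sched U) j T + (t - T) * rate j V"
    if "arrival I j \<le> T" "T \<le> t" for j t
    using work_extend[OF aU' _ that, of V] eqW[of T j] by (simp add: U'_def)
  have before: "unfinished I (sched U') t = U' t" if "t < T" for t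
  proof -
    have "unfinished I (sched U') t = unfinished I (sched U) t"
      using eqW that by (simp add: unfinished_def)
    then show ?thesis using g that by (simp add: good_def U'_def)
  qed
  have after: "unfinished I (sched U') t = V" if t: "T \<le> t" and tE: "\<And>e. e \<in> E \<Longrightarrow> t < e" for t
  proof -
    have arr: "arrival I j \<le> t \<longleftrightarrow> arrival I j \<le> T" if "j < length I" for j
      using t tE[of "arrival I j"] that unfolding E_def by fastforce
    have "work I (sched U') j t < size_of I j \<longleftrightarrow> work I (sched U) j T < size_of I j"
      if j: "j < length I" "arrival I j \<le> T" for j
    proof (cases "j \<in> act V")
      case True
      then have jV: "j \<in> V" using act_subset by blast
      then have v: "vel V > 0" using vel_pos finV by blast
      have "t < T + (size_of I j - work I (sched U) j T) / vel V"
        using tE True unfolding E_def by blast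
      then have "(t - T) * vel V < size_of I j - work I (sched U) j T"
        using v by (simp add: field_simps)
      then show ?thesis using ext[OF j(2) t] True jV
        by (simp add: rate_def V_def unfinished_def)
    next
      case False
      then show ?thesis using ext[OF j(2) t] by (simp add: rate_def)
    qed
    then show ?thesis unfolding V_def unfinished_def using arr by blast
  qed
  show ?thesis
  proof (cases "E = {}")
    case True
    then have "unfinished I (sched U') t = U' t" for t
      using before[of t] after[of t] by (cases "t < T") (auto simp: U'_def)
    then have "good U' T''" for T'' using aU' by (simp add: good_def)
    then show ?thesis by blast
  next
    case False
    define T' where "T' = Min E"
    have T'E: "T' \<in> E" unfolding T'_def using finE False by (rule Min_in)
    have TT': "T < e" if "e \<in> E" for e
    proof -
      have "(size_of I j - work I (sched U) j T) / vel V > 0" if "j \<in> act V" for j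
      proof -
        have "j \<in> V" using that act_subset by blast
        then have "vel V > 0" using vel_pos[OF finV] by blast
        moreover have "size_of I j - work I (sched U) j T > 0"
          using \<open>j \<in> V\<close> by (simp add: V_def unfinished_def)
        ultimately show ?thesis by simp
      qed
      then show ?thesis using that unfolding E_def by auto
    qed
    have lt: "T < T'" using TT'[OF T'E] .
    have gU': "good U' T'"
      unfolding good_def
    proof (intro conjI allI impI aU')
      fix t assume t: "t < T'"
      have "t < e" if "e \<in> E" for e using t Min_le[OF finE that] by (simp add: T'_def)
      then show "unfinished I (sched U') t = U' t"
        using before[of t] after[of t] by (cases "t < T") (auto simp: U'_def)
    qed
    have sub1: "arrived T \<subseteq> arrived T'" using lt by (auto simp: arrived_def)
    have sub2: "fini U T \<subseteq> fini U' T'"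
    proof
      fix j assume j: "j \<in> fini U T"
      then have a: "arrival I j \<le> T" by (simp add: fini_def arrived_def)
      have "(T' - T) * rate j V \<ge> 0" using lt rate_nonneg by simp
      then show "j \<in> fini U' T'" using j ext[OF a] lt sub1 by (auto simp: fini_def)
    qed
    have fin: "finite (arrived t)" for t by (simp add: arrived_def)
    have fin2: "finite (fini u t)" for u t using fin by (simp add: fini_def)
    have le: "card (arrived T) \<le> card (arrived T')" "card (fini U T) \<le> card (fini U' T')"
      using card_mono[OF fin sub1] card_mono[OF fin2 sub2] by auto
    from T'E consider j where "j < length I" "arrival I j > T" "T' = arrival I j"
      | j where "j \<in> act V" "T' = T + (size_of I j - work I (sched U) j T) / vel V"
      unfolding E_def by blast
    then have "card (arrived T) < card (arrived T') \<or> card (fini U T) < card (fini U' T')"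
    proof cases
      case 1
      then have "j \<in> arrived T'" "j \<notin> arrived T" by (simp_all add: arrived_def)
      then have "arrived T \<subset> arrived T'" using sub1 by blast
      then show ?thesis using psubset_card_mono[OF fin] by blast
    next
      case 2
      then have jV: "j \<in> V" using act_subset by blast
      then have a: "arrival I j \<le> T" "j < length I" by (auto simp: V_def unfinished_def)
      have v: "vel V > 0" using vel_pos[OF finV] jV by blast
      have "(T' - T) * rate j V = size_of I j - work I (sched U) j T"
        unfolding 2(2) using 2(1) v by (simp add: rate_def)
      then have "work I (sched U') j T' = size_of I j"
        using ext[OF a(1), of T'] lt by linarith
      then have "j \<in> fini U' T'" using a lt by (simp add: fini_def arrived_def)
      moreover have "j \<notin> fini U T" using jV by (simp add: V_def unfinished_eq)
      ultimately have "fini U T \<subset> fini U' T'" using sub2 by blast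
      then show ?thesis using psubset_card_mono[OF fin2] by blast
    qed
    then show ?thesis using gU' le by (intro disjI2 exI[of _ U'] exI[of _ T']) auto
  qed
qed

private lemma complete:
  "good U T \<Longrightarrow> \<exists>U'. \<forall>T. good U' T"
proof (induction "2 * length I - (card (arrived T) + card (fini U T))" arbitrary: U T rule: less_induct)
  case less
  from step[OF less.prems] show ?case
  proof (elim disjE exE conjE)
    fix U' T' assume *: "good U' T'"
      "card (arrived T) + card (fini U T) < card (arrived T') + card (fini U' T')"
    have "card (arrived T') \<le> length I" "card (fini U' T') \<le> length I"
      using card_mono[of "{..<length I}" "arrived T'"] card_mono[of "{..<length I}" "fini U' T'"]
      by (auto simp: arrived_def fini_def)
    then have "2 * length I - (card (arrived T') + card (fini U' T'))
        < 2 * length I - (card (arrived T) + card (fini U T))" using *(2) by linarith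
    then show ?thesis using less.hyps *(1) by blast
  qed blast
qed

theorem frac_lcfs_equi_nonempty: "frac_lcfs_equi \<alpha> p \<beta> I \<noteq> {}"
proof -
  define T where "T = Min (insert 0 (arrival I ` {..<length I}))"
  have "unfinished I S t = {}" if "t < T" for S t
  proof -
    have "t < arrival I j" if "j < length I" for j
      using \<open>t < T\<close> that by (simp add: T_def)
    then show ?thesis by (auto simp: unfinished_def not_le)
  qed
  then have "good (\<lambda>_. {}) T" by (simp add: good_def adm_def)
  then obtain U where U: "\<And>T. good U T" using complete by blast
  have aU: "adm U" using U by (simp add: good_def)
  have un: "unfinished I (sched U) t = U t" for t
    using U[of "t + 1"] by (simp add: good_def)
  have "{t. server_job (sched U) i t = Some j} \<in> sets borel" for i j
  proof -
    define f :: "nat set \<Rightarrow> real" where "f V = (if i \<in> act V \<and> i = j then 1 else 0)" for V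
    have "{t. server_job (sched U) i t = Some j} = {t \<in> space borel. f (U t) = 1}"
      by (auto simp: sched_def f_def)
    also have "\<dots> \<in> sets borel"
      using adm_measurable[OF aU, of f] by measurable
    finally show ?thesis .
  qed
  moreover have "server_speed (sched U) i \<in> borel_measurable borel" for i
    using adm_measurable[OF aU, of "rate i"] by (simp add: sched_def)
  ultimately have "legal_schedule I (sched U)"
    unfolding legal_schedule_def un using rate_nonneg
    by (auto simp: sched_def rate_def split: if_splits intro: subsetD[OF act_subset])
  moreover have "{j. \<exists>i. server_job (sched U) i t = Some j} = act (U t)" for t
    by (auto simp: sched_def)
  moreover have "server_speed (sched U) i t = vel (U t)" if "server_job (sched U) i t = Some j" for i j t
    using that by (auto simp: sched_def rate_def split: if_splits)
  ultimately have "sched U \<in> frac_lcfs_equi \<alpha> p \<beta> I"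
    unfolding frac_lcfs_equi_def mem_Collect_eq un act_def vel_def Let_def by blast
  then show ?thesis by blast
qed

end

end

theory Submission
  imports Defs
begin

text \<open>
  Let \<open>A\<close> and \<open>B\<close> be the sets of unfinished jobs of the algorithm and of an arbitrary feasible
  schedule at a given time. A job of rank \<open>r\<close> in \<open>A\<close>, in order of arrival, gets the weight
  \<open>max 1 ((r / p) powr (1 / \<alpha>))\<close>. The rank of a job never increases, so for each job the weighted
  work that the algorithm does after the other schedule has finished the job is at most the
  weighted work of the other schedule: both compare with the size of the job times the weight at
  the finishing time.

  At each time, if \<open>card B \<ge> \<gamma> * card A\<close> then the algorithm's cost rate is charged directly to
  the cost rate of the other schedule. Otherwise most of the jobs that are processed by the algorithm are
  outside \<open>B\<close> and have large rank, and their weighted speed is at least a constant times \<open>card A\<close>,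
  whereas by Hoelder's inequality the weighted speed of the other schedule is at most
  \<open>\<gamma> powr (1 - 1 / \<alpha>) * card A\<close> if \<open>card A > p\<close>, and at most its cost rate if \<open>card A \<le> p\<close>.
  Integrating over time and cancelling the weighted work gives the bound.
\<close>

section \<open>Work and unfinished jobs of feasible schedules\<close>

lemma legal_server_unique:
  assumes "legal_schedule I S" "server_job S i t = Some j"
  shows "{i'. server_job S i' t = Some j} = {i}"
  using assms unfolding legal_schedule_def by blast

lemma job_speed_eq:
  assumes "legal_schedule I S" "server_job S i t = Some j"
  shows "job_speed S j t = server_speed S i t"
  unfolding job_speed_def legal_server_unique[OF assms] by simp

lemma job_speed_nonneg: "legal_schedule I S \<Longrightarrow> job_speed S j t \<ge> 0"
  unfolding job_speed_def legal_schedule_def by (intro sum_nonneg) auto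

lemma job_speed_eq_0:
  assumes "legal_schedule I S" "j \<notin> unfinished I S t"
  shows "job_speed S j t = 0"
proof -
  have "{i. server_job S i t = Some j} = {}"
    using assms unfolding legal_schedule_def by blast
  then show ?thesis by (simp add: job_speed_def)
qed

text \<open>The set of servers summed over varies with time, so measurability is obtained from a
  series over all servers; at each time at most one of its terms is nonzero, since no two servers
  share a job.\<close>

lemma job_speed_measurable:
  assumes "legal_schedule I S"
  shows "job_speed S j \<in> borel_measurable borel"
proof -
  define h where "h i t = indicator {t. server_job S i t = Some j} t * server_speed S i t" for i t
  have [measurable]: "{t. server_job S i t = Some j} \<in> sets borel"
    "server_speed S i \<in> borel_measurable borel" for i
    using assms by (auto simp: legal_schedule_def)
  have "job_speed S j t = (\<Sum>i. h i t)" for t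
  proof (cases "\<exists>i. server_job S i t = Some j")
    case True
    then obtain i where i: "server_job S i t = Some j" by blast
    have "i' = i" if "server_job S i' t = Some j" for i'
      using legal_server_unique[OF assms i] that by blast
    then have "(\<Sum>i. h i t) = (\<Sum>i\<in>{i}. h i t)"
      by (intro suminf_finite) (auto simp: h_def indicator_def)
    then show ?thesis using job_speed_eq[OF assms i] i by (simp add: h_def)
  next
    case False
    then show ?thesis by (simp add: h_def job_speed_def)
  qed
  then have "job_speed S j = (\<lambda>t. \<Sum>i. h i t)" by blast
  moreover have "(\<lambda>t. \<Sum>i. h i t) \<in> borel_measurable borel"
    unfolding h_def by measurable
  ultimately show ?thesis by simp
qed

text \<open>Servers running at positive speed correspond injectively to jobs, and all other jobs
  contribute \<open>0 powr \<alpha> = 0\<close>. From here on schedules enter only through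
  \<open>job_speed\<close>.\<close>

lemma total_power_eq:
  assumes "legal_schedule I S"
  shows "total_power \<alpha> S t = (\<Sum>j<length I. job_speed S j t powr \<alpha>)"
proof -
  define Q where "Q = {i. server_speed S i t > 0}"
  define J where "J i = the (server_job S i t)" for i
  have some: "server_job S i t = Some (J i)" if "i \<in> Q" for i
    using assms that by (cases "server_job S i t") (auto simp: legal_schedule_def Q_def J_def)
  have inj: "inj_on J Q"
    using some assms unfolding legal_schedule_def inj_on_def by metis
  have sub: "J ` Q \<subseteq> {..<length I}"
  proof
    fix j assume "j \<in> J ` Q"
    then obtain i where "server_job S i t = Some j" using some by blast
    then have "j \<in> unfinished I S t" using assms unfolding legal_schedule_def by blast
    then show "j \<in> {..<length I}" by (simp add: unfinished_def)
  qed
  \<comment> \<open>A job outside the image may still be assigned to a server, but then that server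
    has speed 0.\<close>
  have zero: "job_speed S j t = 0" if "j \<notin> J ` Q" for j
    unfolding job_speed_def
  proof (intro sum.neutral ballI)
    fix i assume i: "i \<in> {i. server_job S i t = Some j}"
    then have "i \<notin> Q" using that by (force simp: J_def)
    moreover have "server_speed S i t \<ge> 0" using assms by (simp add: legal_schedule_def)
    ultimately show "server_speed S i t = 0" by (simp add: Q_def)
  qed
  have "total_power \<alpha> S t = (\<Sum>i\<in>Q. job_speed S (J i) t powr \<alpha>)"
    unfolding total_power_def Q_def[symmetric] srv_power_def
    by (intro sum.cong refl) (simp add: job_speed_eq[OF assms some])
  also have "\<dots> = (\<Sum>j\<in>J ` Q. job_speed S j t powr \<alpha>)"
    by (simp add: sum.reindex[OF inj])
  also have "\<dots> = (\<Sum>j<length I. job_speed S j t powr \<alpha>)"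
    by (rule sum.mono_neutral_left) (use sub zero in auto)
  finally show ?thesis .
qed

text \<open>The power of one job is at most the total power. The resulting uniform speed bound makes
  speeds integrable over bounded intervals.\<close>

lemma job_speed_le:
  assumes "feasible \<alpha> p I S" "\<alpha> > 0"
  shows "job_speed S j t \<le> p powr (1 / \<alpha>)"
proof -
  have legal: "legal_schedule I S" and P: "total_power \<alpha> S t \<le> p"
    using assms by (auto simp: feasible_def)
  note nonneg = job_speed_nonneg[OF legal]
  show ?thesis
  proof (cases "j < length I")
    case True
    then have "job_speed S j t powr \<alpha> \<le> total_power \<alpha> S t"
      unfolding total_power_eq[OF legal] by (intro member_le_sum) auto
    then have "(job_speed S j t powr \<alpha>) powr (1 / \<alpha>) \<le> p powr (1 / \<alpha>)"
      using P assms by (intro powr_mono2) auto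
    then show ?thesis using assms nonneg[of j t] by (simp add: powr_powr)
  next
    case False
    then have "job_speed S j t = 0"
      by (intro job_speed_eq_0[OF legal]) (simp add: unfinished_def)
    then show ?thesis by simp
  qed
qed

text \<open>\<open>work\<close> is a Bochner integral, which would be 0 for a non-integrable speed;
  the speed bound excludes this. The nonnegative integral is preferable because monotonicity and
  monotone convergence then come without integrability conditions.\<close>

lemma ennreal_work_eq:
  assumes "feasible \<alpha> p I S" "\<alpha> > 0"
  shows "ennreal (work I S j t)
       = (\<integral>\<^sup>+\<tau>. ennreal (job_speed S j \<tau>) * indicator {arrival I j..t} \<tau> \<partial>lborel)"
proof -
  have legal: "legal_schedule I S" using assms by (simp add: feasible_def)
  note nonneg = job_speed_nonneg[OF legal]
  have "integrable lborel (\<lambda>\<tau>. indicator {arrival I j..t} \<tau> *\<^sub>R job_speed S j \<tau>)"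
  proof (rule integrableI_bounded_set_indicator[where B = "p powr (1 / \<alpha>)"])
    show "job_speed S j \<in> borel_measurable lborel"
      using job_speed_measurable[OF legal] by simp
    show "emeasure lborel {arrival I j..t} < \<infinity>" by (cases "arrival I j \<le> t") auto
    show "AE x in lborel. x \<in> {arrival I j..t} \<longrightarrow> norm (job_speed S j x) \<le> p powr (1 / \<alpha>)"
      using job_speed_le[OF assms] nonneg by simp
  qed simp
  then have "ennreal (work I S j t)
      = (\<integral>\<^sup>+\<tau>. ennreal (indicator {arrival I j..t} \<tau> *\<^sub>R job_speed S j \<tau>) \<partial>lborel)"
    unfolding work_def set_lebesgue_integral_def
    by (intro nn_integral_eq_integral[symmetric]) (auto simp: nonneg)
  also have "\<dots> = (\<integral>\<^sup>+\<tau>. ennreal (job_speed S j \<tau>) * indicator {arrival I j..t} \<tau> \<partial>lborel)"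
    by (intro nn_integral_cong) (auto split: split_indicator)
  finally show ?thesis .
qed

lemma work_nonneg: "legal_schedule I S \<Longrightarrow> work I S j t \<ge> 0"
  unfolding work_def set_lebesgue_integral_def
  by (intro integral_nonneg_AE) (auto simp: job_speed_nonneg)

lemma work_mono:
  assumes "feasible \<alpha> p I S" "\<alpha> > 0" "s \<le> t"
  shows "work I S j s \<le> work I S j t"
proof -
  have "ennreal (work I S j s) \<le> ennreal (work I S j t)"
    unfolding ennreal_work_eq[OF assms(1,2)]
    by (intro nn_integral_mono) (use assms(3) in \<open>auto split: split_indicator\<close>)
  then show ?thesis
    using assms(1) by (simp add: ennreal_le_iff work_nonneg feasible_def)
qed

section \<open>The interval of times at which a job is unfinished\<close>

lemma unfinished_backwards:
  assumes "feasible \<alpha> p I S" "\<alpha> > 0" "j \<in> unfinished I S t" "arrival I j \<le> s" "s \<le> t"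
  shows "j \<in> unfinished I S s"
  using assms work_mono[OF assms(1,2,5), of j] by (auto simp: unfinished_def)

lemma unfinished_times_measurable:
  assumes "feasible \<alpha> p I S" "\<alpha> > 0"
  shows "{t. j \<in> unfinished I S t} \<in> sets borel"
proof -
  have "is_interval {t. j \<in> unfinished I S t}"
    unfolding is_interval_1
  proof (intro ballI allI impI)
    fix r t s assume *: "r \<in> {t. j \<in> unfinished I S t}" "t \<in> {t. j \<in> unfinished I S t}"
      "r \<le> s \<and> s \<le> t"
    then have "arrival I j \<le> s" by (auto simp: unfinished_def)
    then show "s \<in> {t. j \<in> unfinished I S t}" using unfinished_backwards[OF assms] * by blast
  qed
  then show ?thesis by (rule real_interval_borel_measurable)
qed

text \<open>At every time of the interval \<open>K\<close> the work done so far is below the size.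
  If \<open>K\<close> has a last element this is the claim; otherwise \<open>K\<close> is exhausted
  by the intervals from \<open>a\<close> to \<open>u n\<close> and monotone convergence applies.
  This also covers jobs that are never finished.\<close>

lemma nn_integral_job_speed_le:
  assumes "feasible \<alpha> p I S" "\<alpha> > 0"
  shows "(\<integral>\<^sup>+t. ennreal (job_speed S j t) * indicator {t. j \<in> unfinished I S t} t \<partial>lborel)
     \<le> ennreal (size_of I j)"
proof (cases "{t. j \<in> unfinished I S t} = {}")
  case False
  define K where "K = {t. j \<in> unfinished I S t}"
  define a where "a = arrival I j"
  have legal: "legal_schedule I S" using assms by (simp add: feasible_def)
  have [measurable]: "job_speed S j \<in> borel_measurable borel"
    using job_speed_measurable[OF legal] .
  have ge: "a \<le> t" if "t \<in> K" for t using that by (auto simp: K_def a_def unfinished_def)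
  have down: "s \<in> K" if "t \<in> K" "a \<le> s" "s \<le> t" for s t
    using unfinished_backwards[OF assms] that by (auto simp: K_def a_def)
  have bound: "(\<integral>\<^sup>+\<tau>. ennreal (job_speed S j \<tau>) * indicator {a..t} \<tau> \<partial>lborel) \<le> ennreal (size_of I j)"
    if "t \<in> K" for t
    unfolding a_def ennreal_work_eq[OF assms, symmetric]
    using that by (intro ennreal_leI) (auto simp: K_def unfinished_def)
  have aK: "a \<in> K" using False down[OF _ order_refl ge] unfolding K_def by blast
  have "\<exists>u::nat \<Rightarrow> real. incseq u \<and> (\<forall>n. u n \<in> K) \<and> (\<forall>t\<in>K. (\<forall>s\<in>K. s \<le> t) \<or> (\<exists>n. t \<le> u n))"
  proof (cases "bdd_above K")
    case True
    \<comment> \<open>The maximum with \<open>a\<close> keeps these approximations of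
      \<open>Sup K\<close> inside \<open>K\<close>.\<close>
    define u where "u n = max a (Sup K - inverse (real (Suc n)))" for n
    have "inverse (real (Suc n)) \<le> inverse (real (Suc m))" if "m \<le> n" for m n
      using that by (intro le_imp_inverse_le) auto
    then have "incseq u"
      unfolding incseq_def u_def by (intro allI impI max.mono order_refl diff_left_mono)
    moreover have "u n \<in> K" for n
    proof -
      have "Sup K - inverse (real (Suc n)) < Sup K" by simp
      then obtain t where "t \<in> K" "Sup K - inverse (real (Suc n)) < t"
        using less_cSup_iff[OF _ True] aK by blast
      then show ?thesis using down[of t "u n"] ge[of t] by (auto simp: u_def)
    qed
    moreover have "(\<forall>s\<in>K. s \<le> t) \<or> (\<exists>n. t \<le> u n)" if "t \<in> K" for t
    proof (cases "t < Sup K")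
      case True
      then obtain n where "inverse (real (Suc n)) < Sup K - t"
        using reals_Archimedean[of "Sup K - t"] by auto
      then have "t \<le> u n" by (auto simp: u_def)
      then show ?thesis by blast
    next
      case False
      then show ?thesis using cSup_upper[OF _ True] by force
    qed
    ultimately show ?thesis by blast
  next
    case unb: False
    have "a + real n \<in> K" for n
    proof -
      obtain t where "t \<in> K" "a + real n \<le> t"
        using unb unfolding bdd_above_def by (meson linear)
      then show ?thesis using down by simp
    qed
    moreover have "\<exists>n. t \<le> a + real n" for t
      using real_arch_simple[of "t - a"] by (auto simp: algebra_simps)
    ultimately show ?thesis
      by (intro exI[of _ "\<lambda>n. a + real n"]) (auto simp: incseq_def)
  qed
  then obtain u :: "nat \<Rightarrow> real" where u: "incseq u" "\<And>n. u n \<in> K"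
    and cof: "\<And>t. t \<in> K \<Longrightarrow> (\<forall>s\<in>K. s \<le> t) \<or> (\<exists>n. t \<le> u n)" by blast
  show ?thesis
  proof (cases "\<exists>t\<in>K. \<forall>s\<in>K. s \<le> t")
    case True
    then obtain t where t: "t \<in> K" "\<forall>s\<in>K. s \<le> t" by blast
    have "K \<subseteq> {a..t}" using t(2) ge by (meson atLeastAtMost_iff subsetI)
    moreover have "{a..t} \<subseteq> K" using down[OF t(1)] by (meson atLeastAtMost_iff subsetI)
    ultimately have "K = {a..t}" by (rule antisym)
    then show ?thesis using bound[OF t(1)] by (simp add: K_def)
  next
    case nomax: False
    define h where "h n \<tau> = ennreal (job_speed S j \<tau>) * indicator {a..u n} \<tau>" for n \<tau>
    have "(SUP n. h n \<tau>) = ennreal (job_speed S j \<tau>) * indicator K \<tau>" for \<tau>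
    proof (cases "\<tau> \<in> K")
      case True
      then obtain n where "\<tau> \<le> u n" using cof nomax by blast
      then have "h n \<tau> = ennreal (job_speed S j \<tau>)" using ge[OF True] by (simp add: h_def)
      moreover have "h m \<tau> \<le> ennreal (job_speed S j \<tau>)" for m
        by (auto simp: h_def split: split_indicator)
      ultimately have "(SUP n. h n \<tau>) = ennreal (job_speed S j \<tau>)"
        by (intro antisym SUP_least) (metis SUP_upper UNIV_I)+
      then show ?thesis using True by simp
    next
      case False
      then have "\<tau> \<notin> {a..u n}" for n using down[OF u(2)] by auto
      then have "h n \<tau> = 0" for n by (auto simp: h_def)
      then show ?thesis using False by simp
    qed
    then have "(\<integral>\<^sup>+\<tau>. ennreal (job_speed S j \<tau>) * indicator K \<tau> \<partial>lborel)
        = (\<integral>\<^sup>+\<tau>. (SUP n. h n \<tau>) \<partial>lborel)" by simp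
    also have "\<dots> = (SUP n. \<integral>\<^sup>+\<tau>. h n \<tau> \<partial>lborel)"
    proof (rule nn_integral_monotone_convergence_SUP)
      show "incseq h"
        unfolding h_def incseq_def le_fun_def
      proof (intro allI impI mult_left_mono)
        fix m n :: nat and x :: real
        assume "m \<le> n"
        then have "u m \<le> u n" using u(1) by (simp add: incseq_def)
        then show "(indicator {a..u m} x :: ennreal) \<le> indicator {a..u n} x"
          by (auto split: split_indicator)
      qed simp
      show "h n \<in> borel_measurable lborel" for n unfolding h_def by measurable
    qed
    also have "\<dots> \<le> ennreal (size_of I j)"
      unfolding h_def by (intro SUP_least bound u)
    finally show ?thesis by (simp add: K_def)
  qed
qed simp

section \<open>The rate inequality at a fixed time\<close>

lemma card_most_recent_ge:
  assumes "finite U" "k \<le> card U"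
  shows "k \<le> card (most_recent k U)"
proof (cases "U - most_recent k U = {}")
  case True
  then have "most_recent k U = U" by (auto simp: most_recent_def)
  then show ?thesis using assms by simp
next
  case False
  \<comment> \<open>The newest unselected job: everything newer is selected, and being unselected it
    has at least \<open>k\<close> newer jobs.\<close>
  define m where "m = Max (U - most_recent k U)"
  have fin: "finite (U - most_recent k U)" using assms by simp
  have m: "m \<in> U - most_recent k U" unfolding m_def by (rule Max_in[OF fin False])
  have "i \<in> most_recent k U" if "i \<in> U" "m < i" for i
    using Max_ge[OF fin, of i] that unfolding m_def[symmetric] by force
  then have "card {i \<in> U. m < i} \<le> card (most_recent k U)"
    using assms by (intro card_mono) (auto simp: most_recent_def)
  moreover have "k \<le> card {i \<in> U. m < i}" using m by (auto simp: most_recent_def)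
  ultimately show ?thesis by linarith
qed

lemma lcfs_count_bounds:
  assumes "0 < \<beta>" "\<beta> < 1"
  shows "\<beta> * real n \<le> real (lcfs_count \<beta> n)"
    and "real (lcfs_count \<beta> n) < \<beta> * real n + 1"
    and "lcfs_count \<beta> n \<le> n"
proof -
  have nonneg: "0 \<le> \<lceil>\<beta> * real n\<rceil>"
    using assms by (simp add: ceiling_mono[of 0, simplified])
  then have eq: "real (lcfs_count \<beta> n) = of_int \<lceil>\<beta> * real n\<rceil>"
    by (simp add: lcfs_count_def)
  show "\<beta> * real n \<le> real (lcfs_count \<beta> n)" "real (lcfs_count \<beta> n) < \<beta> * real n + 1"
    unfolding eq by linarith+
  have "\<beta> * real n \<le> real n" using assms by (simp add: mult_left_le_one_le)
  then have "\<lceil>\<beta> * real n\<rceil> \<le> int n" by (simp add: ceiling_le_iff)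
  then show "lcfs_count \<beta> n \<le> n" unfolding lcfs_count_def by linarith
qed

text \<open>A selected job has at most \<open>lcfs_count \<beta> (card A) - 1\<close> newer jobs.
  Counting the job itself in its rank compensates the rounding up, so the factor
  \<open>1 - \<beta>\<close> is exact.\<close>

lemma rank_most_recent_ge:
  assumes "finite A" "0 < \<beta>" "\<beta> < 1" "j \<in> most_recent (lcfs_count \<beta> (card A)) A"
  shows "(1 - \<beta>) * real (card A) \<le> real (card {i \<in> A. i \<le> j})"
proof -
  have "A = {i \<in> A. i \<le> j} \<union> {i \<in> A. j < i}" by auto
  then have "card A = card {i \<in> A. i \<le> j} + card {i \<in> A. j < i}"
    using assms(1) by (subst card_Un_disjoint[symmetric]) auto
  moreover have "card {i \<in> A. j < i} + 1 \<le> lcfs_count \<beta> (card A)"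
    using assms(4) by (simp add: most_recent_def)
  ultimately show ?thesis
    using lcfs_count_bounds(2)[OF assms(2,3), of "card A"] by (simp add: algebra_simps)
qed

text \<open>For \<open>n > p\<close> the algorithm's speed is
  \<open>(p / k) powr (1 / \<alpha>)\<close>; multiplied by
  \<open>(r / p) powr (1 / \<alpha>)\<close> with \<open>r\<close> of order \<open>n\<close> it is
  comparable to \<open>(n / k) powr (1 / \<alpha>)\<close>, free of \<open>p\<close>. For
  \<open>n \<le> p\<close> the speed already has that value and weight 1 suffices, hence the
  maximum. The value 0 outside \<open>A\<close> lets weighted sums run over all jobs.\<close>

definition rank_weight :: "real \<Rightarrow> real \<Rightarrow> nat set \<Rightarrow> nat \<Rightarrow> real" where
  "rank_weight \<alpha> p A j =
     (if j \<in> A then max 1 ((real (card {i \<in> A. i \<le> j}) / p) powr (1 / \<alpha>)) else 0)"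

lemma rank_weight_nonneg: "rank_weight \<alpha> p A j \<ge> 0"
  by (simp add: rank_weight_def max.coboundedI1)

lemma rank_weight_le:
  assumes "finite A" "\<alpha> > 0" "p > 0"
  shows "rank_weight \<alpha> p A j \<le> max 1 ((real (card A) / p) powr (1 / \<alpha>))"
proof -
  have "card {i \<in> A. i \<le> j} \<le> card A" using assms by (intro card_mono) auto
  then have "(real (card {i \<in> A. i \<le> j}) / p) powr (1 / \<alpha>) \<le> (real (card A) / p) powr (1 / \<alpha>)"
    using assms by (intro powr_mono2 divide_right_mono) auto
  then show ?thesis by (auto simp: rank_weight_def)
qed

text \<open>Young's inequality with the power in one factor and a free level \<open>l\<close> in the
  other. Level 1 serves light load; the average power per job gives Hoelder's inequality.\<close>

lemma speed_Young:
  fixes x l :: real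
  assumes "\<alpha> > 1" "l > 0" "x \<ge> 0"
  shows "x * l powr (1 - 1 / \<alpha>) \<le> (1 / \<alpha>) * x powr \<alpha> + (1 - 1 / \<alpha>) * l"
proof (cases "x = 0")
  case False
  have "(x powr \<alpha>) powr (1 / \<alpha>) * l powr (1 - 1 / \<alpha>) \<le> (1 / \<alpha>) * x powr \<alpha> + (1 - 1 / \<alpha>) * l"
    using assms False by (intro Youngs_inequality_0) auto
  then show ?thesis using assms by (simp add: powr_powr)
qed (use assms in simp)

lemma sum_speed_le_Hoelder:
  fixes x :: "'a \<Rightarrow> real"
  assumes "\<alpha> > 1" "P > 0" "finite J" "\<And>j. x j \<ge> 0" "(\<Sum>j\<in>J. x j powr \<alpha>) \<le> P"
  shows "(\<Sum>j\<in>J. x j) \<le> P powr (1 / \<alpha>) * real (card J) powr (1 - 1 / \<alpha>)"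
proof (cases "J = {}")
  case False
  define m where "m = real (card J)"
  \<comment> \<open>The average power is the level at which Young's inequality is tight when all
    speeds are equal; after summation the right side is at most \<open>P\<close>.\<close>
  define l where "l = P / m"
  have m: "m > 0" using False assms by (simp add: m_def card_gt_0_iff)
  then have l: "l > 0" using assms by (simp add: l_def)
  have "(\<Sum>j\<in>J. x j) * l powr (1 - 1 / \<alpha>)
      \<le> (\<Sum>j\<in>J. (1 / \<alpha>) * x j powr \<alpha> + (1 - 1 / \<alpha>) * l)"
    unfolding sum_distrib_right by (intro sum_mono speed_Young assms l)
  also have "\<dots> = (1 / \<alpha>) * (\<Sum>j\<in>J. x j powr \<alpha>) + (1 - 1 / \<alpha>) * P"
    using m by (simp add: sum.distrib sum_distrib_left l_def m_def)
  also have "\<dots> \<le> (1 / \<alpha>) * P + (1 - 1 / \<alpha>) * P"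
    using assms by (intro add_right_mono mult_left_mono) auto
  also have "\<dots> = P" by (simp add: algebra_simps)
  also have "\<dots> = (P powr (1 / \<alpha>) * m powr (1 - 1 / \<alpha>)) * l powr (1 - 1 / \<alpha>)"
    using m assms by (simp add: l_def powr_divide powr_add[symmetric])
  finally show ?thesis using l by (simp add: m_def)
qed simp

text \<open>At least \<open>k - card B\<close> of the processed jobs lie outside \<open>B\<close>, a
  fraction of at least \<open>1 - \<gamma> / \<beta>\<close>, since
  \<open>k \<ge> \<beta> * n\<close>. Each of them has rank at least
  \<open>(1 - \<beta>) * n\<close> and hence weighted speed at least \<open>w\<close>, a bound in
  which \<open>p\<close> cancels.\<close>

lemma lcfs_progress:
  assumes "\<alpha> > 1" "p > 0" "0 < \<beta>" "\<beta> < 1" "0 < \<gamma>" "\<gamma> < \<beta>" "finite A" "finite B"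
    and few: "real (card B) \<le> \<gamma> * real (card A)"
  shows "(1 - \<beta>) powr (1 / \<alpha>) * \<beta> powr (1 - 1 / \<alpha>) * (1 - \<gamma> / \<beta>) * real (card A)
    \<le> (\<Sum>j\<in>most_recent (lcfs_count \<beta> (card A)) A - B.
          rank_weight \<alpha> p A j * lcfs_speed \<alpha> p \<beta> (card A))"
proof (cases "A = {}")
  case False
  define n where "n = card A"
  define a where "a = 1 / \<alpha>"
  define k where "k = lcfs_count \<beta> n"
  define M where "M = most_recent k A"
  define s where "s = lcfs_speed \<alpha> p \<beta> n"
  define w where "w = ((1 - \<beta>) * real n / real k) powr a"
  have n: "n > 0" using False assms by (simp add: n_def card_gt_0_iff)
  have k: "k > 0" using lcfs_count_pos n assms by (simp add: k_def)
  have a: "a > 0" "a < 1" using assms by (auto simp: a_def)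
  have kn: "\<beta> * real n \<le> real k" using lcfs_count_bounds assms by (simp add: k_def)
  have s: "s = (min (real n) p / real k) powr a"
    using assms by (simp add: s_def lcfs_speed_def srv_power_inv_eq k_def a_def)
  have M: "M \<subseteq> A" "finite M" using assms by (auto simp: M_def most_recent_def)
  have each: "w \<le> rank_weight \<alpha> p A j * s" if j: "j \<in> M - B" for j
  proof -
    define r where "r = real (card {i \<in> A. i \<le> j})"
    have r: "(1 - \<beta>) * real n \<le> r"
      using rank_most_recent_ge[of A \<beta> j] j assms by (simp add: r_def M_def k_def n_def)
    have wt: "rank_weight \<alpha> p A j = max 1 ((r / p) powr a)"
      using j M by (auto simp: rank_weight_def r_def a_def)
    show ?thesis
    proof (cases "real n \<le> p")
      case True
      have "w \<le> 1 * (real n / real k) powr a"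
        unfolding w_def using assms a k
        by (auto intro!: powr_mono2 divide_right_mono simp: mult_left_le_one_le)
      also have "\<dots> \<le> rank_weight \<alpha> p A j * s"
        unfolding s wt using True by (intro mult_mono) auto
      finally show ?thesis .
    next
      case np: False
      have "w = ((1 - \<beta>) * real n / p) powr a * (p / real k) powr a"
        using assms k by (simp add: w_def powr_mult[symmetric])
      also have "\<dots> \<le> (r / p) powr a * (p / real k) powr a"
        using r a assms by (intro mult_right_mono powr_mono2 divide_right_mono) auto
      also have "\<dots> \<le> rank_weight \<alpha> p A j * s"
        unfolding s wt using np by (intro mult_mono) (auto simp: min_def)
      finally show ?thesis .
    qed
  qed
  have "k \<le> card M"
    unfolding M_def using assms lcfs_count_bounds(3)[of \<beta> n]
    by (intro card_most_recent_ge) (auto simp: k_def n_def)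
  moreover have "card M - card B \<le> card (M - B)"
    by (rule diff_card_le_card_Diff) (use assms in auto)
  ultimately have cnt: "real k - real (card B) \<le> real (card (M - B))" by linarith
  have "(1 - \<gamma> / \<beta>) * real k = real k - \<gamma> * (real k / \<beta>)" by (simp add: algebra_simps)
  also have "\<dots> \<le> real k - \<gamma> * real n"
    using kn assms by (intro diff_left_mono mult_left_mono) (auto simp: field_simps)
  also have "\<dots> \<le> real (card (M - B))" using cnt few by (simp add: n_def)
  finally have cnt2: "(1 - \<gamma> / \<beta>) * real k \<le> real (card (M - B))" .
  \<comment> \<open>As a function of \<open>k\<close>, \<open>k * w\<close> is a multiple of
    \<open>k powr (1 - a)\<close> and thus increasing, so \<open>k\<close> may be replaced by its
    lower bound \<open>\<beta> * n\<close>.\<close>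
  have "(1 - \<beta>) powr a * \<beta> powr (1 - a) * real n
      = (1 - \<beta>) powr a * real n powr a * (\<beta> * real n) powr (1 - a)"
    using assms n by (simp add: powr_mult powr_add[symmetric])
  also have "\<dots> \<le> (1 - \<beta>) powr a * real n powr a * real k powr (1 - a)"
    using kn assms a by (intro mult_left_mono powr_mono2) auto
  also have "\<dots> = real k * w"
    using assms k by (simp add: w_def powr_mult powr_divide powr_diff)
  finally have "(1 - \<beta>) powr a * \<beta> powr (1 - a) * real n * (1 - \<gamma> / \<beta>)
      \<le> real k * w * (1 - \<gamma> / \<beta>)"
    using assms by (intro mult_right_mono) auto
  also have "\<dots> = (1 - \<gamma> / \<beta>) * real k * w" by simp
  also have "\<dots> \<le> real (card (M - B)) * w"
    using cnt2 by (intro mult_right_mono) (auto simp: w_def)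
  also have "\<dots> = (\<Sum>j\<in>M - B. w)" by simp
  also have "\<dots> \<le> (\<Sum>j\<in>M - B. rank_weight \<alpha> p A j * s)"
    by (intro sum_mono each)
  finally show ?thesis by (simp add: a_def n_def k_def M_def s_def mult_ac)
qed (simp add: most_recent_def)

text \<open>All weights are at most 1 here, and Young's inequality at level 1 bounds each speed by
  \<open>1 + x j powr \<alpha>\<close>, the job's own share of the cost rate.\<close>

lemma weighted_speed_le_low_load:
  assumes "\<alpha> > 1" "p > 0" "finite A" "\<And>j. x j \<ge> 0" "real (card A) \<le> p"
  shows "(\<Sum>j\<in>B. rank_weight \<alpha> p A j * x j) \<le> real (card B) + (\<Sum>j\<in>B. x j powr \<alpha>)"
proof -
  have "rank_weight \<alpha> p A j * x j \<le> 1 + x j powr \<alpha>" for j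
  proof -
    have "(real (card A) / p) powr (1 / \<alpha>) \<le> 1 powr (1 / \<alpha>)"
      using assms by (intro powr_mono2) auto
    then have "rank_weight \<alpha> p A j \<le> 1" using rank_weight_le[of A \<alpha> p j] assms by simp
    then have "rank_weight \<alpha> p A j * x j \<le> 1 * x j"
      using assms by (intro mult_right_mono) auto
    also have "\<dots> \<le> (1 / \<alpha>) * x j powr \<alpha> + (1 - 1 / \<alpha>)"
      using speed_Young[of \<alpha> 1 "x j"] assms by simp
    also have "\<dots> \<le> 1 * x j powr \<alpha> + 1"
      using assms by (intro add_mono mult_right_mono) auto
    finally show ?thesis by simp
  qed
  then have "(\<Sum>j\<in>B. rank_weight \<alpha> p A j * x j) \<le> (\<Sum>j\<in>B. 1 + x j powr \<alpha>)"
    by (intro sum_mono)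
  then show ?thesis by (simp add: sum.distrib)
qed

text \<open>Hoelder's inequality with total power \<open>p\<close> yields a factor
  \<open>p powr (1 / \<alpha>)\<close>, which cancels against the uniform weight bound.\<close>

lemma weighted_speed_le_high_load:
  assumes "\<alpha> > 1" "p > 0" "finite A" "finite B" "\<And>j. x j \<ge> 0" "p \<le> real (card A)"
    and "(\<Sum>j\<in>B. x j powr \<alpha>) \<le> p"
  shows "(\<Sum>j\<in>B. rank_weight \<alpha> p A j * x j)
    \<le> real (card A) powr (1 / \<alpha>) * real (card B) powr (1 - 1 / \<alpha>)"
proof -
  have "1 powr (1 / \<alpha>) \<le> (real (card A) / p) powr (1 / \<alpha>)"
    using assms by (intro powr_mono2) auto
  then have wt: "rank_weight \<alpha> p A j \<le> (real (card A) / p) powr (1 / \<alpha>)" for j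
    using rank_weight_le[of A \<alpha> p j] assms by simp
  have "(\<Sum>j\<in>B. rank_weight \<alpha> p A j * x j) \<le> (\<Sum>j\<in>B. (real (card A) / p) powr (1 / \<alpha>) * x j)"
    using assms by (intro sum_mono mult_right_mono wt) auto
  also have "\<dots> = (real (card A) / p) powr (1 / \<alpha>) * (\<Sum>j\<in>B. x j)"
    by (simp add: sum_distrib_left)
  also have "\<dots> \<le> (real (card A) / p) powr (1 / \<alpha>)
      * (p powr (1 / \<alpha>) * real (card B) powr (1 - 1 / \<alpha>))"
    using assms by (intro mult_left_mono sum_speed_le_Hoelder) auto
  also have "\<dots> = real (card A) powr (1 / \<alpha>) * real (card B) powr (1 - 1 / \<alpha>)"
    using assms by (simp add: powr_divide)
  finally show ?thesis .
qed

text \<open>The number \<open>c\<close> is the price of a unit of weighted work: it must turn the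
  gap between the algorithm's progress and the other schedule's weighted speed into
  \<open>2 * card A\<close>, which bounds flow plus power. In the final factor,
  \<open>2 / \<gamma>\<close> pays for \<open>2 * card A\<close> when \<open>B\<close> is large and
  the second summand pays for the other schedule's weighted speed.\<close>

lemma local_competitiveness:
  assumes "\<alpha> > 1" "p > 0" "0 < \<beta>" "\<beta> < 1" "0 < \<gamma>" "\<gamma> < \<beta>" "c \<ge> 0"
    and c: "2 \<le> c * ((1 - \<beta>) powr (1 / \<alpha>) * \<beta> powr (1 - 1 / \<alpha>) * (1 - \<gamma> / \<beta>)
                     - \<gamma> powr (1 - 1 / \<alpha>))"
    and fin: "finite A" "finite B" and x: "\<And>j. x j \<ge> 0" "(\<Sum>j\<in>B. x j powr \<alpha>) \<le> p"
  shows "2 * real (card A) + c * (\<Sum>j\<in>B. rank_weight \<alpha> p A j * x j)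
    \<le> c * (\<Sum>j\<in>most_recent (lcfs_count \<beta> (card A)) A - B.
              rank_weight \<alpha> p A j * lcfs_speed \<alpha> p \<beta> (card A))
      + (2 / \<gamma> + c * \<gamma> powr - (1 / \<alpha>)) * (real (card B) + (\<Sum>j\<in>B. x j powr \<alpha>))"
    (is "2 * ?n + c * ?X \<le> c * ?Y + ?R * (?m + ?P)")
proof -
  define a where "a = 1 / \<alpha>"
  define D where "D = (1 - \<beta>) powr a * \<beta> powr (1 - a) * (1 - \<gamma> / \<beta>)"
  have a: "0 < a" "a < 1" using assms by (auto simp: a_def)
  have c': "2 \<le> c * (D - \<gamma> powr (1 - a))" using c by (simp add: D_def a_def)
  have P: "?P \<ge> 0" by (intro sum_nonneg) simp
  have Y: "?Y \<ge> 0"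
    using assms by (intro sum_nonneg mult_nonneg_nonneg rank_weight_nonneg lcfs_speed_nonneg) auto
  have \<gamma>a: "1 \<le> \<gamma> powr - a" using a assms by (simp add: powr_minus_divide powr_le1)
  have R: "2 / \<gamma> + c * \<gamma> powr - a = ?R" by (simp add: a_def)
  show ?thesis
  proof (cases "?m \<le> \<gamma> * ?n")
    case few: True
    have Y': "D * ?n \<le> ?Y"
      using lcfs_progress[of \<alpha> p \<beta> \<gamma> A B] assms few by (simp add: D_def a_def)
    have Dn: "2 * ?n \<le> c * (D - \<gamma> powr (1 - a)) * ?n"
      using c' by (intro mult_right_mono) auto
    have cY: "c * (D * ?n) \<le> c * ?Y" using Y' assms by (intro mult_left_mono) auto
    show ?thesis
    proof (cases "?n \<le> p")
      case True
      \<comment> \<open>Under light load the other schedule's cost rate pays for \<open>?X\<close>,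
        and the subtracted term in the assumption on \<open>c\<close> is left over as slack.\<close>
      have "c * ?X \<le> c * (?m + ?P)"
        using assms True by (intro mult_left_mono weighted_speed_le_low_load) auto
      also have "\<dots> \<le> ?R * (?m + ?P)"
      proof (rule mult_right_mono)
        have "c * 1 \<le> c * \<gamma> powr - a" using \<gamma>a assms by (intro mult_left_mono) auto
        moreover have "0 \<le> 2 / \<gamma>" using assms by simp
        ultimately show "c \<le> ?R" unfolding R[symmetric] by linarith
      qed (use P in auto)
      finally have "c * ?X \<le> ?R * (?m + ?P)" .
      moreover have "0 \<le> c * (\<gamma> powr (1 - a) * ?n)" using assms by simp
      ultimately show ?thesis using Dn cY by (simp add: algebra_simps)
    next
      case False
      \<comment> \<open>Under heavy load \<open>?X\<close> is at most
        \<open>\<gamma> powr (1 - a) * ?n\<close>, exactly the term subtracted in the assumption on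
        \<open>c\<close>.\<close>
      have "?X \<le> ?n powr a * ?m powr (1 - a)"
        unfolding a_def using assms False by (intro weighted_speed_le_high_load) auto
      also have "\<dots> \<le> ?n powr a * (\<gamma> * ?n) powr (1 - a)"
        using few a by (intro mult_left_mono powr_mono2) auto
      also have "\<dots> = \<gamma> powr (1 - a) * ?n"
        using assms by (cases "card A = 0") (auto simp: powr_mult powr_add[symmetric])
      finally have "c * ?X \<le> c * (\<gamma> powr (1 - a) * ?n)" using assms by (intro mult_left_mono) auto
      moreover have "0 \<le> ?R * (?m + ?P)"
        using assms P by (intro mult_nonneg_nonneg add_nonneg_nonneg) auto
      ultimately show ?thesis using Dn cY by (simp add: algebra_simps)
    qed
  next
    case many: False
    then have n: "?n \<le> ?m / \<gamma>" using assms by (simp add: field_simps)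
    have X: "?X \<le> \<gamma> powr - a * (?m + ?P)"
    proof (cases "?n \<le> p")
      case True
      have "?X \<le> 1 * (?m + ?P)"
        using assms True weighted_speed_le_low_load[of \<alpha> p A x B] by simp
      also have "\<dots> \<le> \<gamma> powr - a * (?m + ?P)" using \<gamma>a P by (intro mult_right_mono) auto
      finally show ?thesis .
    next
      case False
      have "?X \<le> ?n powr a * ?m powr (1 - a)"
        unfolding a_def using assms False by (intro weighted_speed_le_high_load) auto
      also have "\<dots> \<le> (?m / \<gamma>) powr a * ?m powr (1 - a)"
        using n a by (intro mult_right_mono powr_mono2) auto
      also have "\<dots> = \<gamma> powr - a * ?m"
        using assms
        by (cases "card B = 0") (auto simp: powr_divide powr_minus_divide powr_add[symmetric])
      also have "\<dots> \<le> \<gamma> powr - a * (?m + ?P)" using P by (intro mult_left_mono) auto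
      finally show ?thesis .
    qed
    have "c * ?X \<le> c * (\<gamma> powr - a * (?m + ?P))" using X assms by (intro mult_left_mono) auto
    moreover have "2 * ?n \<le> 2 / \<gamma> * (?m + ?P)"
    proof -
      have "2 * ?n \<le> 2 / \<gamma> * ?m" using n by simp
      also have "\<dots> \<le> 2 / \<gamma> * (?m + ?P)" using P assms by (intro mult_left_mono) auto
      finally show ?thesis .
    qed
    moreover have "0 \<le> c * ?Y" using Y assms by simp
    moreover have "?R * (?m + ?P) = 2 / \<gamma> * (?m + ?P) + c * (\<gamma> powr - a * (?m + ?P))"
      unfolding R[symmetric] by (simp only: distrib_right mult.assoc)
    ultimately show ?thesis by linarith
  qed
qed

section \<open>Integration over time\<close>

lemma arrival_mono:
  assumes "valid_input I" "i \<le> j" "j < length I"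
  shows "arrival I i \<le> arrival I j"
  using assms sorted_nth_mono[of "map fst I" i j] by (simp add: valid_input_def arrival_def)

text \<open>Indices follow arrival order, so later arrivals never enter the rank of
  \<open>j\<close>, and every job counted at time \<open>t\<close> was already present and
  unfinished at time \<open>s\<close>.\<close>

lemma rank_weight_antimono:
  assumes "valid_input I" "feasible \<alpha> p I S" "\<alpha> > 0" "p > 0"
    and "arrival I j \<le> s" "s \<le> t" "j \<in> unfinished I S t"
  shows "rank_weight \<alpha> p (unfinished I S t) j \<le> rank_weight \<alpha> p (unfinished I S s) j"
proof -
  have js: "j \<in> unfinished I S s" using unfinished_backwards assms by blast
  have "{i \<in> unfinished I S t. i \<le> j} \<subseteq> {i \<in> unfinished I S s. i \<le> j}"
  proof safe
    fix i assume i: "i \<in> unfinished I S t" "i \<le> j"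
    have "arrival I i \<le> s"
      using arrival_mono[OF assms(1) i(2)] assms by (auto simp: unfinished_def)
    then show "i \<in> unfinished I S s" using unfinished_backwards assms i by blast
  qed
  then have "card {i \<in> unfinished I S t. i \<le> j} \<le> card {i \<in> unfinished I S s. i \<le> j}"
    by (intro card_mono) (simp_all add: finite_unfinished)
  then have "(real (card {i \<in> unfinished I S t. i \<le> j}) / p) powr (1 / \<alpha>)
      \<le> (real (card {i \<in> unfinished I S s. i \<le> j}) / p) powr (1 / \<alpha>)"
    using assms by (intro powr_mono2 divide_right_mono) auto
  then show ?thesis using js assms(7) by (simp add: rank_weight_def max.mono)
qed

lemma rank_weight_measurable:
  assumes "feasible \<alpha> p I S" "\<alpha> > 0"
  shows "(\<lambda>t. rank_weight \<alpha> p (unfinished I S t) j) \<in> borel_measurable borel"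
proof -
  have [measurable]: "Measurable.pred borel (\<lambda>t. i \<in> unfinished I S t)" for i
    using unfinished_times_measurable[OF assms] by (simp add: pred_def)
  have "real (card {i \<in> unfinished I S t. i \<le> j})
      = (\<Sum>i | i < length I \<and> i \<le> j. if i \<in> unfinished I S t then 1 else 0)" for t
  proof -
    have "{i \<in> unfinished I S t. i \<le> j} = {i \<in> {i. i < length I \<and> i \<le> j}. i \<in> unfinished I S t}"
      by (auto simp: unfinished_def)
    then show ?thesis by (simp add: sum.If_cases Int_def)
  qed
  then show ?thesis unfolding rank_weight_def by simp
qed

text \<open>Let \<open>t0\<close> have maximal weight among the times at which only \<open>S\<close>
  still has \<open>j\<close> unfinished. The left side is at most \<open>W t0\<close> times the
  size. By \<open>t0\<close> the schedule \<open>S'\<close> has done at least that much work, all of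
  it at times where the weight was at least \<open>W t0\<close>.\<close>

lemma nn_integral_weighted_speed_exchange:
  assumes "valid_input I" "feasible \<alpha> p I S" "feasible \<alpha> p I S'" "\<alpha> > 0" "p > 0" "j < length I"
  shows "(\<integral>\<^sup>+t. ennreal (of_bool (j \<notin> unfinished I S' t) *
             (rank_weight \<alpha> p (unfinished I S t) j * job_speed S j t)) \<partial>lborel)
    \<le> (\<integral>\<^sup>+t. ennreal (rank_weight \<alpha> p (unfinished I S t) j * job_speed S' j t) \<partial>lborel)"
    (is "?L \<le> ?R")
proof -
  define W where "W t = rank_weight \<alpha> p (unfinished I S t) j" for t
  define B where "B = {t. j \<in> unfinished I S t \<and> j \<notin> unfinished I S' t}"
  have W0: "W t \<ge> 0" for t by (simp add: W_def rank_weight_nonneg)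
  have legal: "legal_schedule I S" "legal_schedule I S'" using assms by (auto simp: feasible_def)
  note [measurable] = unfinished_times_measurable[OF assms(2,4)]
    job_speed_measurable[OF legal(1)] job_speed_measurable[OF legal(2)]
  note v0 = job_speed_nonneg[OF legal(1)] job_speed_nonneg[OF legal(2)]
  have Wz: "W t = 0" if "j \<notin> unfinished I S t" for t using that by (simp add: W_def rank_weight_def)
  show ?thesis
  proof (cases "B = {}")
    case True
    then have "of_bool (j \<notin> unfinished I S' t) * (W t * job_speed S j t) = 0" for t
      using Wz[of t] by (auto simp: B_def)
    then have "?L = 0" unfolding W_def[symmetric] by (simp only: nn_integral_const) simp
    then show ?thesis by simp
  next
    case False
    \<comment> \<open>The weight takes finitely many values, so its maximum over \<open>B\<close> is
      attained; this avoids asking whether \<open>B\<close> has a first time.\<close>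
    have "finite (W ` B)"
    proof (rule finite_subset)
      show "W ` B \<subseteq> (\<lambda>A. rank_weight \<alpha> p A j) ` Pow {..<length I}"
        by (auto simp: W_def unfinished_def)
    qed simp
    then have "Max (W ` B) \<in> W ` B" "\<And>t. t \<in> B \<Longrightarrow> W t \<le> Max (W ` B)"
      using False by auto
    then obtain t0 where t0: "t0 \<in> B" "\<And>t. t \<in> B \<Longrightarrow> W t \<le> W t0" by auto
    have "?L \<le> (\<integral>\<^sup>+t. ennreal (W t0) *
        (ennreal (job_speed S j t) * indicator {t. j \<in> unfinished I S t} t) \<partial>lborel)"
    proof (rule nn_integral_mono)
      fix t
      show "ennreal (of_bool (j \<notin> unfinished I S' t) *
          (rank_weight \<alpha> p (unfinished I S t) j * job_speed S j t))
        \<le> ennreal (W t0) * (ennreal (job_speed S j t) * indicator {t. j \<in> unfinished I S t} t)"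
      proof (cases "t \<in> B")
        case True
        then have "ennreal (W t * job_speed S j t) \<le> ennreal (W t0 * job_speed S j t)"
          using t0(2) v0 by (intro ennreal_leI mult_right_mono) auto
        then show ?thesis
          using True W0 v0 by (simp add: B_def W_def[symmetric] ennreal_mult)
      next
        case False
        then show ?thesis using Wz[of t] by (auto simp: B_def W_def)
      qed
    qed
    also have "\<dots> = ennreal (W t0) *
        (\<integral>\<^sup>+t. ennreal (job_speed S j t) * indicator {t. j \<in> unfinished I S t} t \<partial>lborel)"
      by (rule nn_integral_cmult) measurable
    also have "\<dots> \<le> ennreal (W t0) * ennreal (size_of I j)"
      by (intro mult_left_mono nn_integral_job_speed_le[OF assms(2,4)]) simp
    also have "\<dots> \<le> ennreal (W t0) * ennreal (work I S' j t0)"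
      using t0(1) assms(6)
      by (intro mult_left_mono ennreal_leI) (auto simp: B_def unfinished_def not_less)
    also have "\<dots> = (\<integral>\<^sup>+t. ennreal (W t0) *
        (ennreal (job_speed S' j t) * indicator {arrival I j..t0} t) \<partial>lborel)"
      unfolding ennreal_work_eq[OF assms(3,4)]
      by (rule nn_integral_cmult[symmetric]) measurable
    also have "\<dots> \<le> ?R"
    proof (rule nn_integral_mono)
      fix t
      show "ennreal (W t0) * (ennreal (job_speed S' j t) * indicator {arrival I j..t0} t)
        \<le> ennreal (rank_weight \<alpha> p (unfinished I S t) j * job_speed S' j t)"
      proof (cases "t \<in> {arrival I j..t0}")
        case True
        then have "W t0 \<le> W t"
          unfolding W_def using t0(1) by (intro rank_weight_antimono assms) (auto simp: B_def)
        then have "ennreal (W t0 * job_speed S' j t) \<le> ennreal (W t * job_speed S' j t)"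
          using v0 by (intro ennreal_leI mult_right_mono) auto
        then show ?thesis using True W0 v0 by (simp add: W_def[symmetric] ennreal_mult)
      qed simp
    qed
    finally show ?thesis .
  qed
qed

lemma frac_lcfs_equi_job_speed:
  assumes "S \<in> frac_lcfs_equi \<alpha> p \<beta> I"
  shows "job_speed S j t =
    (if j \<in> most_recent (lcfs_count \<beta> (card (unfinished I S t))) (unfinished I S t)
     then lcfs_speed \<alpha> p \<beta> (card (unfinished I S t)) else 0)"
proof -
  have legal: "legal_schedule I S"
    and jobs: "{j. \<exists>i. server_job S i t = Some j}
      = most_recent (lcfs_count \<beta> (card (unfinished I S t))) (unfinished I S t)"
    and speed: "\<And>i j. server_job S i t = Some j
      \<Longrightarrow> server_speed S i t = lcfs_speed \<alpha> p \<beta> (card (unfinished I S t))"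
    using assms by (auto simp: frac_lcfs_equi_def Let_def)
  show ?thesis
  proof (cases "\<exists>i. server_job S i t = Some j")
    case True
    then obtain i where i: "server_job S i t = Some j" by blast
    show ?thesis
      using True job_speed_eq[OF legal i] speed[OF i] unfolding jobs[symmetric] by simp
  next
    case False
    then show ?thesis unfolding jobs[symmetric] by (simp add: job_speed_def)
  qed
qed

text \<open>At most \<open>k\<close> jobs run at power \<open>min n p / k\<close> each. The energy
  rate is thus bounded by the flow rate.\<close>

lemma frac_lcfs_equi_total_power_le:
  assumes "S \<in> frac_lcfs_equi \<alpha> p \<beta> I" "\<alpha> > 0" "p > 0"
  shows "total_power \<alpha> S t \<le> real (card (unfinished I S t))"
proof -
  define U where "U = unfinished I S t"
  define n where "n = card U"
  define k where "k = lcfs_count \<beta> n"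
  have legal: "legal_schedule I S" using assms by (simp add: frac_lcfs_equi_def)
  have fin: "finite U" by (simp add: U_def finite_unfinished)
  have sub: "most_recent k U \<subseteq> {..<length I}"
    by (auto simp: most_recent_def U_def unfinished_def)
  have "total_power \<alpha> S t
      = (\<Sum>j<length I. if j \<in> most_recent k U then min (real n) p / real k else 0)"
    unfolding total_power_eq[OF legal]
    using assms
    by (intro sum.cong refl)
       (simp add: frac_lcfs_equi_job_speed[OF assms(1)] U_def[symmetric] n_def[symmetric]
          k_def[symmetric] lcfs_speed_def srv_power_inv_eq powr_powr)
  also have "\<dots> = (\<Sum>j\<in>most_recent k U. min (real n) p / real k)"
    using sub by (simp add: sum.If_cases Int_absorb1)
  also have "\<dots> = real (card (most_recent k U)) * (min (real n) p / real k)" by simp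
  also have "\<dots> \<le> real k * (min (real n) p / real k)"
    using card_most_recent_le[OF fin, of k] assms by (intro mult_right_mono) auto
  also have "\<dots> \<le> real n" by (cases "k = 0") auto
  finally show ?thesis by (simp add: n_def U_def)
qed

text \<open>Finiteness is what later permits cancelling the weighted work in \<open>ennreal\<close>.
  The weight is bounded in terms of the number of jobs, and the total work on \<open>j\<close> by
  its size.\<close>

lemma nn_integral_weighted_speed_finite:
  assumes "feasible \<alpha> p I S" "feasible \<alpha> p I S'" "\<alpha> > 0" "p > 0"
  shows "(\<integral>\<^sup>+t. ennreal (rank_weight \<alpha> p (unfinished I S t) j * job_speed S' j t) \<partial>lborel) < \<infinity>"
proof -
  define F where "F = max 1 ((real (length I) / p) powr (1 / \<alpha>))"
  have legal: "legal_schedule I S'" using assms by (simp add: feasible_def)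
  note [measurable] = job_speed_measurable[OF legal] unfinished_times_measurable[OF assms(2,3)]
  note v0 = job_speed_nonneg[OF legal]
  have le: "rank_weight \<alpha> p (unfinished I S t) j \<le> F" for t
  proof -
    have "card (unfinished I S t) \<le> card {..<length I}"
      by (intro card_mono) (auto simp: unfinished_def)
    then have "(real (card (unfinished I S t)) / p) powr (1 / \<alpha>) \<le> (real (length I) / p) powr (1 / \<alpha>)"
      using assms by (intro powr_mono2 divide_right_mono) auto
    then show ?thesis
      using rank_weight_le[OF finite_unfinished assms(3,4), of I S t j] by (auto simp: F_def)
  qed
  have F0: "F \<ge> 0" by (simp add: F_def max.coboundedI1)
  have "(\<integral>\<^sup>+t. ennreal (rank_weight \<alpha> p (unfinished I S t) j * job_speed S' j t) \<partial>lborel)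
      \<le> (\<integral>\<^sup>+t. ennreal F * (ennreal (job_speed S' j t) * indicator {t. j \<in> unfinished I S' t} t) \<partial>lborel)"
  proof (rule nn_integral_mono)
    fix t
    have "ennreal (rank_weight \<alpha> p (unfinished I S t) j * job_speed S' j t) \<le> ennreal (F * job_speed S' j t)"
      using le v0 by (intro ennreal_leI mult_right_mono) auto
    also have "\<dots> = ennreal F * (ennreal (job_speed S' j t) * indicator {t. j \<in> unfinished I S' t} t)"
      using job_speed_eq_0[OF legal, of j t] v0 F0
      by (cases "j \<in> unfinished I S' t") (auto simp: ennreal_mult)
    finally show "ennreal (rank_weight \<alpha> p (unfinished I S t) j * job_speed S' j t)
      \<le> ennreal F * (ennreal (job_speed S' j t) * indicator {t. j \<in> unfinished I S' t} t)" .
  qed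
  also have "\<dots> = ennreal F *
      (\<integral>\<^sup>+t. ennreal (job_speed S' j t) * indicator {t. j \<in> unfinished I S' t} t \<partial>lborel)"
    by (rule nn_integral_cmult) measurable
  also have "\<dots> \<le> ennreal F * ennreal (size_of I j)"
    by (intro mult_left_mono nn_integral_job_speed_le[OF assms(2,3)]) simp
  also have "\<dots> < \<infinity>" by (simp add: ennreal_mult_less_top)
  finally show ?thesis .
qed

section \<open>The cost as one integral, and the comparison of two schedules\<close>

lemma total_power_measurable:
  assumes "legal_schedule I S"
  shows "total_power \<alpha> S \<in> borel_measurable borel"
proof -
  note [measurable] = job_speed_measurable[OF assms]
  have "total_power \<alpha> S = (\<lambda>t. \<Sum>j<length I. job_speed S j t powr \<alpha>)"
    using total_power_eq[OF assms] by blast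
  then show ?thesis by simp
qed

lemma card_unfinished_measurable:
  assumes "feasible \<alpha> p I S" "\<alpha> > 0"
  shows "(\<lambda>t. real (card (unfinished I S t))) \<in> borel_measurable borel"
proof -
  have [measurable]: "Measurable.pred borel (\<lambda>t. i \<in> unfinished I S t)" for i
    using unfinished_times_measurable[OF assms] by (simp add: pred_def)
  have "real (card (unfinished I S t)) = (\<Sum>i<length I. if i \<in> unfinished I S t then 1 else 0)" for t
  proof -
    have "unfinished I S t = {i \<in> {..<length I}. i \<in> unfinished I S t}"
      by (auto simp: unfinished_def)
    then show ?thesis by (simp add: sum.If_cases Int_def)
  qed
  then show ?thesis by simp
qed

lemma total_power_nonneg: "total_power \<alpha> S t \<ge> 0"
  unfolding total_power_def srv_power_def by (intro sum_nonneg) simp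

lemma cost_eq:
  assumes "feasible \<alpha> p I S" "\<alpha> > 0"
  shows "cost \<alpha> I S
    = (\<integral>\<^sup>+t. ennreal (real (card (unfinished I S t)) + total_power \<alpha> S t) \<partial>lborel)"
proof -
  have legal: "legal_schedule I S" using assms by (simp add: feasible_def)
  note [measurable] = card_unfinished_measurable[OF assms] total_power_measurable[OF legal]
  have "cost \<alpha> I S = (\<integral>\<^sup>+t. ennreal (real (card (unfinished I S t))) \<partial>lborel)
      + (\<integral>\<^sup>+t. ennreal (total_power \<alpha> S t) \<partial>lborel)"
    by (simp add: cost_def ennreal_of_nat_eq_real_of_nat)
  also have "\<dots> = (\<integral>\<^sup>+t. ennreal (real (card (unfinished I S t)))
      + ennreal (total_power \<alpha> S t) \<partial>lborel)"
    by (rule nn_integral_add[symmetric]) measurable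
  finally show ?thesis by (simp add: total_power_nonneg)
qed

text \<open>The inequality at a fixed time is integrated, the integral of \<open>Y\<close> is
  replaced by that of \<open>X\<close>, and the latter is cancelled. Only this finite quantity is
  cancelled, so the costs themselves may be infinite.\<close>

lemma cost_competitive:
  assumes valid: "valid_input I" and S: "S \<in> frac_lcfs_equi \<alpha> p \<beta> I" and S': "feasible \<alpha> p I S'"
    and par: "\<alpha> > 1" "p > 0" "0 < \<beta>" "\<beta> < 1" "0 < \<gamma>" "\<gamma> < \<beta>" "c \<ge> 0"
      "2 \<le> c * ((1 - \<beta>) powr (1 / \<alpha>) * \<beta> powr (1 - 1 / \<alpha>) * (1 - \<gamma> / \<beta>) - \<gamma> powr (1 - 1 / \<alpha>))"
  shows "cost \<alpha> I S \<le> ennreal (2 / \<gamma> + c * \<gamma> powr - (1 / \<alpha>)) * cost \<alpha> I S'"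
proof -
  have \<alpha>: "\<alpha> > 0" using par by simp
  have feas: "feasible \<alpha> p I S" using frac_lcfs_equi_feasible[OF \<alpha> par(2) S] .
  have legal: "legal_schedule I S" "legal_schedule I S'" using feas S' by (auto simp: feasible_def)
  define R where "R = 2 / \<gamma> + c * \<gamma> powr - (1 / \<alpha>)"
  define w where "w t j = rank_weight \<alpha> p (unfinished I S t) j" for t j
  define X where "X t = (\<Sum>j<length I. w t j * job_speed S' j t)" for t
  define Y where "Y t = (\<Sum>j<length I. of_bool (j \<notin> unfinished I S' t) * (w t j * job_speed S j t))" for t
  define K where "K t = real (card (unfinished I S t)) + total_power \<alpha> S t" for t
  define K' where "K' t = real (card (unfinished I S' t)) + total_power \<alpha> S' t" for t
  have R0: "R \<ge> 0" using par by (simp add: R_def)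
  have w0: "w t j \<ge> 0" for t j by (simp add: w_def rank_weight_nonneg)
  note v0 = job_speed_nonneg[OF legal(1)] job_speed_nonneg[OF legal(2)]
  have X0: "X t \<ge> 0" for t unfolding X_def by (intro sum_nonneg mult_nonneg_nonneg w0 v0)
  have Y0: "Y t \<ge> 0" for t unfolding Y_def by (intro sum_nonneg mult_nonneg_nonneg w0 v0) auto
  have K0: "K t \<ge> 0" "K' t \<ge> 0" for t by (auto simp: K_def K'_def total_power_nonneg)
  have [measurable]: "Measurable.pred borel (\<lambda>t. i \<in> unfinished I S' t)" for i
    using unfinished_times_measurable[OF S' \<alpha>] by (simp add: pred_def)
  have [measurable]: "(\<lambda>t. w t j) \<in> borel_measurable borel" for j
    unfolding w_def by (rule rank_weight_measurable[OF feas \<alpha>])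
  note [measurable] = job_speed_measurable[OF legal(1)] job_speed_measurable[OF legal(2)]
    card_unfinished_measurable[OF feas \<alpha>] card_unfinished_measurable[OF S' \<alpha>]
    total_power_measurable[OF legal(1)] total_power_measurable[OF legal(2)]
  have [measurable]: "X \<in> borel_measurable borel" "Y \<in> borel_measurable borel"
    "K \<in> borel_measurable borel" "K' \<in> borel_measurable borel"
    unfolding X_def[abs_def] Y_def[abs_def] K_def[abs_def] K'_def[abs_def] by measurable
  \<comment> \<open>\<open>X\<close> and \<open>Y\<close> sum over all jobs so that sum and integral
    can be interchanged; at a fixed time they reduce to the sums over \<open>B\<close> and over the
    processed jobs outside \<open>B\<close>, because the other speeds vanish.\<close>
  have ptw: "K t + c * X t \<le> c * Y t + R * K' t" for t
  proof -
    define A where "A = unfinished I S t"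
    define B where "B = unfinished I S' t"
    have AB: "A \<subseteq> {..<length I}" "B \<subseteq> {..<length I}" by (auto simp: A_def B_def unfinished_def)
    have fin: "finite A" "finite B" by (auto simp: A_def B_def finite_unfinished)
    have off: "job_speed S' j t = 0" if "j \<notin> B" for j
      using job_speed_eq_0[OF legal(2)] that by (simp add: B_def)
    have P: "total_power \<alpha> S' t = (\<Sum>j\<in>B. job_speed S' j t powr \<alpha>)"
      unfolding total_power_eq[OF legal(2)]
      by (rule sum.mono_neutral_right) (use AB off in auto)
    have Xt: "X t = (\<Sum>j\<in>B. rank_weight \<alpha> p A j * job_speed S' j t)"
      unfolding X_def w_def A_def[symmetric]
      by (rule sum.mono_neutral_right) (use AB off in auto)
    have "Y t = (\<Sum>j\<in>most_recent (lcfs_count \<beta> (card A)) A - B.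
        of_bool (j \<notin> B) * (rank_weight \<alpha> p A j * job_speed S j t))"
      unfolding Y_def w_def A_def[symmetric] B_def[symmetric]
      by (rule sum.mono_neutral_right)
         (use AB in \<open>auto simp: frac_lcfs_equi_job_speed[OF S] A_def[symmetric] most_recent_def\<close>)
    also have "\<dots> = (\<Sum>j\<in>most_recent (lcfs_count \<beta> (card A)) A - B.
        rank_weight \<alpha> p A j * lcfs_speed \<alpha> p \<beta> (card A))"
      by (intro sum.cong) (auto simp: frac_lcfs_equi_job_speed[OF S] A_def[symmetric])
    finally have Yt: "Y t = \<dots>" .
    have Pp: "(\<Sum>j\<in>B. job_speed S' j t powr \<alpha>) \<le> p"
      using S' P by (metis feasible_def)
    have "2 * real (card A) + c * X t \<le> c * Y t + R * K' t"
      unfolding Xt Yt R_def K'_def P B_def[symmetric]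
      by (rule local_competitiveness) (use par fin v0 Pp in auto)
    moreover have "K t \<le> 2 * real (card A)"
      using frac_lcfs_equi_total_power_le[OF S \<alpha> par(2), of t] by (simp add: K_def A_def)
    ultimately show ?thesis by linarith
  qed
  have YX: "(\<integral>\<^sup>+t. ennreal (Y t) \<partial>lborel) \<le> (\<integral>\<^sup>+t. ennreal (X t) \<partial>lborel)"
  proof -
    have "(\<integral>\<^sup>+t. ennreal (Y t) \<partial>lborel)
        = (\<Sum>j<length I. \<integral>\<^sup>+t. ennreal (of_bool (j \<notin> unfinished I S' t) * (w t j * job_speed S j t)) \<partial>lborel)"
      unfolding Y_def
      by (subst nn_integral_sum[symmetric]) (auto simp: w0 v0)
    also have "\<dots> \<le> (\<Sum>j<length I. \<integral>\<^sup>+t. ennreal (w t j * job_speed S' j t) \<partial>lborel)"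
      unfolding w_def using valid feas S' \<alpha> par by (intro sum_mono nn_integral_weighted_speed_exchange) auto
    also have "\<dots> = (\<integral>\<^sup>+t. ennreal (X t) \<partial>lborel)"
      unfolding X_def
      by (subst nn_integral_sum[symmetric]) (auto simp: w0 v0)
    finally show ?thesis .
  qed
  have Xfin: "(\<integral>\<^sup>+t. ennreal (X t) \<partial>lborel) < \<infinity>"
  proof -
    have "(\<integral>\<^sup>+t. ennreal (X t) \<partial>lborel)
        = (\<Sum>j<length I. \<integral>\<^sup>+t. ennreal (w t j * job_speed S' j t) \<partial>lborel)"
      unfolding X_def
      by (subst nn_integral_sum[symmetric]) (auto simp: w0 v0)
    also have "\<dots> < \<infinity>"
      unfolding w_def
      using nn_integral_weighted_speed_finite[OF feas S' \<alpha> par(2)] by simp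
    finally show ?thesis .
  qed
  have "cost \<alpha> I S + ennreal c * (\<integral>\<^sup>+t. ennreal (X t) \<partial>lborel)
      = (\<integral>\<^sup>+t. ennreal (K t + c * X t) \<partial>lborel)"
    using K0 X0 par
    by (simp add: cost_eq[OF feas \<alpha>] K_def[symmetric] nn_integral_add nn_integral_cmult ennreal_mult)
  also have "\<dots> \<le> (\<integral>\<^sup>+t. ennreal (c * Y t + R * K' t) \<partial>lborel)"
    by (intro nn_integral_mono ennreal_leI ptw)
  also have "\<dots> = ennreal c * (\<integral>\<^sup>+t. ennreal (Y t) \<partial>lborel) + ennreal R * cost \<alpha> I S'"
    using K0 Y0 R0 par
    by (simp add: cost_eq[OF S' \<alpha>] K'_def[symmetric] nn_integral_add nn_integral_cmult ennreal_mult)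
  also have "\<dots> \<le> ennreal c * (\<integral>\<^sup>+t. ennreal (X t) \<partial>lborel) + ennreal R * cost \<alpha> I S'"
    by (intro add_right_mono mult_left_mono YX) simp
  finally have "ennreal c * (\<integral>\<^sup>+t. ennreal (X t) \<partial>lborel) + cost \<alpha> I S
      \<le> ennreal c * (\<integral>\<^sup>+t. ennreal (X t) \<partial>lborel) + ennreal R * cost \<alpha> I S'"
    by (simp add: add.commute)
  moreover have "ennreal c * (\<integral>\<^sup>+t. ennreal (X t) \<partial>lborel) \<noteq> \<infinity>"
    using Xfin by (simp add: ennreal_mult_eq_top_iff)
  ultimately show ?thesis unfolding R_def by (simp add: ennreal_add_left_cancel_le)
qed

section \<open>From pairs of schedules to the competitive ratio\<close>

lemma competitive_ratio_leI:
  assumes "R > 0"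
    and "\<And>I S S'. valid_input I \<Longrightarrow> S \<in> A I \<Longrightarrow> feasible \<alpha> p I S' \<Longrightarrow> cost \<alpha> I S \<le> ennreal R * cost \<alpha> I S'"
  shows "competitive_ratio \<alpha> p A \<le> ennreal R"
  unfolding competitive_ratio_def
proof (intro SUP_least)
  fix I S assume "I \<in> {I. valid_input I}" and S: "S \<in> A I"
  then have I: "valid_input I" by simp
  \<comment> \<open>Division by \<open>R\<close> makes the left side a lower bound for every
    feasible cost, hence for the infimum.\<close>
  have "cost \<alpha> I S / ennreal R \<le> opt_cost \<alpha> p I"
    unfolding opt_cost_def
  proof (rule INF_greatest)
    fix S' assume "S' \<in> {S. feasible \<alpha> p I S}"
    then show "cost \<alpha> I S / ennreal R \<le> cost \<alpha> I S'"
      using assms(2)[OF I S] assms(1) by (intro divide_le_posI_ennreal) (auto simp: mult.commute)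
  qed
  then have "ennreal R * (cost \<alpha> I S / ennreal R) \<le> ennreal R * opt_cost \<alpha> p I"
    by (intro mult_left_mono) auto
  moreover have "ennreal R * (cost \<alpha> I S / ennreal R) = cost \<alpha> I S"
    using assms(1) ennreal_mult_divide_eq[of "ennreal R" "cost \<alpha> I S"]
    by (simp add: ennreal_times_divide mult.commute)
  ultimately have *: "cost \<alpha> I S \<le> ennreal R * opt_cost \<alpha> p I" by simp
  show "cost \<alpha> I S / opt_cost \<alpha> p I \<le> ennreal R"
  \<comment> \<open>If the optimum is 0, so is the algorithm's cost, and \<open>0 / 0 = 0\<close> in
    \<open>ennreal\<close>.\<close>
  proof (cases "opt_cost \<alpha> p I = 0")
    case True
    then show ?thesis using * by simp
  next
    case False
    then show ?thesis using * by (intro divide_le_posI_ennreal) (auto simp: mult.commute zero_less_iff_neq_zero)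
  qed
qed

lemma frac_lcfs_equi_competitive:
  assumes "\<alpha> > 1" "p > 0" "0 < \<beta>" "\<beta> < 1" "0 < \<gamma>" "\<gamma> < \<beta>" "c \<ge> 0"
    and "2 \<le> c * ((1 - \<beta>) powr (1 / \<alpha>) * \<beta> powr (1 - 1 / \<alpha>) * (1 - \<gamma> / \<beta>)
                  - \<gamma> powr (1 - 1 / \<alpha>))"
  shows "competitive_ratio \<alpha> p (frac_lcfs_equi \<alpha> p \<beta>)
    \<le> ennreal (2 / \<gamma> + c * \<gamma> powr - (1 / \<alpha>))"
proof (rule competitive_ratio_leI)
  show "2 / \<gamma> + c * \<gamma> powr - (1 / \<alpha>) > 0" using assms by (simp add: add_pos_nonneg)
qed (rule cost_competitive; use assms in simp)

theorem theorem3: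
  shows "(\<forall>\<alpha>>1. \<exists>\<beta>. 0 < \<beta> \<and> \<beta> < 1 \<and>
            (\<exists>C::real. \<forall>p>0. competitive_ratio \<alpha> p (frac_lcfs_equi \<alpha> p \<beta>) \<le> ennreal C)) \<and>
         (\<forall>\<alpha> p. 2 \<le> \<alpha> \<and> \<alpha> \<le> 3 \<and> 0 < p \<longrightarrow>
            competitive_ratio \<alpha> p (frac_lcfs_equi \<alpha> p (1/6)) \<le> 693)"
proof (intro conjI allI impI)
  fix \<alpha> :: real assume \<alpha>: "\<alpha> > 1"
  define a where "a = 1 / \<alpha>"
  \<comment> \<open>Chosen so that \<open>\<gamma> powr (1 - a) = 1 / 8\<close>. With
    \<open>\<beta> = 1/2\<close> the progress is at least \<open>1/2 * (1 - 2 / 8) = 3/8\<close>, so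
    the gap is at least \<open>1/4\<close> and \<open>c = 8\<close> suffices.\<close>
  define \<gamma> :: real where "\<gamma> = (1 / 8) powr (1 / (1 - a))"
  have a: "0 < a" "a < 1" using \<alpha> by (auto simp: a_def)
  have \<gamma>0: "0 < \<gamma>" by (simp add: \<gamma>_def)
  have "1 \<le> 1 / (1 - a)" using a by simp
  then have "\<gamma> \<le> (1 / 8) powr 1" unfolding \<gamma>_def by (intro powr_mono') auto
  then have \<gamma>8: "\<gamma> \<le> 1 / 8" by simp
  have \<gamma>a: "\<gamma> powr (1 - a) = 1 / 8" using a by (simp add: \<gamma>_def powr_powr)
  have half: "(1 - 1/2) powr a * (1/2) powr (1 - a) = (1/2 :: real)"
    by (simp add: powr_add[symmetric])
  have "2 \<le> 8 * ((1 - 1/2) powr a * (1/2) powr (1 - a) * (1 - \<gamma> / (1/2)) - \<gamma> powr (1 - a))"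
    unfolding half \<gamma>a using \<gamma>8 by simp
  then have "competitive_ratio \<alpha> p (frac_lcfs_equi \<alpha> p (1/2))
      \<le> ennreal (2 / \<gamma> + 8 * \<gamma> powr - (1 / \<alpha>))" if "p > 0" for p
    using \<alpha> \<gamma>0 \<gamma>8 that unfolding a_def by (intro frac_lcfs_equi_competitive) auto
  then show "\<exists>\<beta>. 0 < \<beta> \<and> \<beta> < 1 \<and>
      (\<exists>C::real. \<forall>p>0. competitive_ratio \<alpha> p (frac_lcfs_equi \<alpha> p \<beta>) \<le> ennreal C)"
    by (intro exI[of _ "1/2"]) auto
next
  fix \<alpha> p :: real assume "2 \<le> \<alpha> \<and> \<alpha> \<le> 3 \<and> 0 < p"
  then have \<alpha>: "2 \<le> \<alpha>" "\<alpha> \<le> 3" and p: "0 < p" by auto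
  define a where "a = 1 / \<alpha>"
  have a: "1/3 \<le> a" "a \<le> 1/2" using \<alpha> by (auto simp: a_def field_simps)
  \<comment> \<open>The product for \<open>\<beta> = 1/6\<close> equals \<open>5 powr a / 6\<close>;
    a rational lower bound follows from \<open>a \<ge> 1/3\<close> and
    \<open>1.7 ^ 3 = 4.913 < 5\<close>.\<close>
  have "(1.7 :: real) = (1.7 ^ 3) powr (1/3)" by (simp add: powr_powr flip: powr_numeral)
  also have "\<dots> \<le> 5 powr (1/3)" by (intro powr_mono2) (auto simp: power3_eq_cube)
  also have "\<dots> \<le> 5 powr a" using a by (intro powr_mono) auto
  also have "5 powr a / 6 = (5/6) powr a * (1/6) powr (1 - a)"
    by (simp add: powr_divide powr_diff)
  finally have D: "1.7 / 6 \<le> (5/6 :: real) powr a * (1/6) powr (1 - a)" by simp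
  have "(1/64 :: real) powr (1 - a) \<le> (1/64) powr (1/2)" using a by (intro powr_mono') auto
  also have "\<dots> = 1/8" using real_sqrt_unique[of "1/8" "1/64"] by (simp add: powr_half_sqrt power2_eq_square)
  finally have g: "(1/64 :: real) powr (1 - a) \<le> 1/8" .
  have "(1/64 :: real) powr - a = 64 powr a" by (simp add: powr_minus_divide powr_divide)
  also have "\<dots> \<le> 64 powr (1/2)" using a by (intro powr_mono) auto
  also have "\<dots> = 8" using real_sqrt_unique[of 8 64] by (simp add: powr_half_sqrt)
  finally have h: "(1/64 :: real) powr - a \<le> 8" .
  \<comment> \<open>Here \<open>\<gamma> = 1/64\<close>, whose square root is rational. The gap is
    at least \<open>1.7 / 6 * (58/64) - 1/8 > 0.13\<close>, so \<open>c = 20\<close> is enough, and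
    the ratio is at most \<open>128 + 20 * 8 = 288\<close>.\<close>
  have "2 \<le> 20 * ((1 - 1/6) powr a * (1/6) powr (1 - a) * (1 - (1/64) / (1/6)) - (1/64 :: real) powr (1 - a))"
    using D g by (simp add: algebra_simps)
  then have "competitive_ratio \<alpha> p (frac_lcfs_equi \<alpha> p (1/6))
      \<le> ennreal (2 / (1/64) + 20 * (1/64) powr - (1 / \<alpha>))"
    using \<alpha> p unfolding a_def by (intro frac_lcfs_equi_competitive) auto
  also have "\<dots> \<le> ennreal 693" using h by (intro ennreal_leI) (simp add: a_def)
  finally show "competitive_ratio \<alpha> p (frac_lcfs_equi \<alpha> p (1/6)) \<le> 693" by simp
qed

end
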